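(* Let $X$ be a $CAT(0)$ space and let $\Gamma$ be a group acting by isometries on $X$. Suppose that $\Gamma$ is not virtually cyclic, that the action satisfies $WPD$, and that $\Gamma$ contains an element that acts as a rank 1 isometry of $X$. Then the real vector space $\widetilde{QH}(\Gamma)$ is infinite-dimensional.
   Context: $X$ is not assumed to be proper or complete. $|a-b|$ denotes the distance $d(a,b)$ and $[a,b]$ the geodesic from $a$ to $b$. Quasi-homomorphisms: a function $\phi:\Gamma\to\mathbb{R}$ is a quasi-homomorphism if $\sup_{x,y\in\Gamma}|\phi(xy)-\phi(x)-\phi(y)|<\infty$. $\widetilde{QH}(\Gamma)$ is the quotient of the vector space of all quasi-homomorphisms $\Gamma\to\mathbb{R}$ by the subspace $Hom(\Gamma,\mathbb{R})+\{\text{bounded functions }\Gamma\to\mathbb{R}\}$. Contracting segments: for a geodesic segment $[a,b]$ and $x\in X$, $\pi_{ab}(x)$ is the set of points of $[a,b]$ minimizing the distance to $x$, and for $K\subset X$, $\pi_{ab}(K)=\bigcup_{x\in K}\pi_{ab}(x)$. For $B>0$, $[a,b]$ is $B$-contracting if for every metric ball $K$ disjoint from $[a,b]$ the projection $\pi_{ab}(K)$ has diameter $<B$. Rank 1: two subsets of $X$ are $B$-Hausdorff equivalent if each is contained in the $B$-neighborhood of the other. Fix a basepoint $x_0\in X$. An isometry $g:X\to X$ is rank 1 if, with $x_n=g^n(x_0)$, $|x_n-x_0|\to\infty$ as $n\to\infty$ and there is $B>0$ such that for every $n>0$ the geodesic $[x_0,x_n]$ is $B$-Hausdorff equivalent to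 $\{x_0,x_1,\dots,x_n\}$ and is $B$-contracting. (This does not depend on the choice of $x_0$.) WPD (weak proper discontinuity): the action of $\Gamma$ on $X$ satisfies $WPD$ if $\Gamma$ is not virtually cyclic, $\Gamma$ contains at least one rank 1 element, and for every rank 1 element $g\in\Gamma$ and every $c>0$ there exists $M>0$ such that the set $\{\gamma\in\Gamma : |x_0-\gamma(x_0)|\le c,\ |g^M(x_0)-\gamma g^M(x_0)|\le c\}$ is finite. (This does not depend on the choice of $x_0$.) *)

theory Defs
  imports "HOL-Analysis.Analysis"
begin

section \<open>CAT(0) spaces\<close>

definition (in metric_space) geodesic_segment :: "'a \<Rightarrow> 'a \<Rightarrow> 'a set \<Rightarrow> bool" where
  "geodesic_segment a b S \<longleftrightarrow>
     (\<exists>c :: real \<Rightarrow> 'a. c 0 = a \<and> c (dist a b) = b \<and>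
        (\<forall>s\<in>{0..dist a b}. \<forall>t\<in>{0..dist a b}. dist (c s) (c t) = \<bar>s - t\<bar>) \<and>
        S = c ` {0..dist a b})"

definition (in metric_space) comparison_point ::
  "'a \<Rightarrow> 'a set \<Rightarrow> real^2 \<Rightarrow> real^2 \<Rightarrow> 'a \<Rightarrow> real^2 \<Rightarrow> bool" where
  "comparison_point a S a' b' x x' \<longleftrightarrow>
     x \<in> S \<and> x' \<in> closed_segment a' b' \<and> norm (a' - x') = dist a x"

text \<open>
  A geodesic space in which every geodesic triangle, with sides \<open>S1\<close>, \<open>S2\<close>, \<open>S3\<close> and
  vertices \<open>p\<close>, \<open>q\<close>, \<open>r\<close>, is no thicker than its comparison triangle in the Euclidean plane.
\<close>

class cat0_space = metric_space +
  assumes geodesic_space: "\<exists>S. geodesic_segment a b S"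
  and cat0_inequality:
    "\<lbrakk>geodesic_segment p q S1; geodesic_segment q r S2; geodesic_segment r p S3;
      norm (p' - q') = dist p q; norm (q' - r') = dist q r; norm (r' - p') = dist r p;
      comparison_point p S1 p' q' x x' \<or> comparison_point q S2 q' r' x x' \<or>
        comparison_point r S3 r' p' x x';
      comparison_point p S1 p' q' y y' \<or> comparison_point q S2 q' r' y y' \<or>
        comparison_point r S3 r' p' y y'\<rbrakk>
     \<Longrightarrow> dist x y \<le> norm (x' - y')"

definition geodesic :: "'a::cat0_space \<Rightarrow> 'a \<Rightarrow> 'a set" where
  "geodesic a b = (THE S. geodesic_segment a b S)"

lemma geodesic_segment_singleton: "geodesic_segment a a {a::'a::metric_space}"
  unfolding geodesic_segment_def by (rule exI[of _ "\<lambda>_. a"]) auto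

lemma geodesic_segment_commute:
  fixes a b :: "'a::metric_space"
  assumes "geodesic_segment a b S"
  shows "geodesic_segment b a S"
proof -
  obtain c where c: "c 0 = a" "c (dist a b) = b" "S = c ` {0..dist a b}"
    "\<And>s t. s \<in> {0..dist a b} \<Longrightarrow> t \<in> {0..dist a b} \<Longrightarrow> dist (c s) (c t) = \<bar>s - t\<bar>"
    using assms unfolding geodesic_segment_def by metis
  let ?c = "\<lambda>s. c (dist a b - s)"
  have "(\<lambda>s. dist a b - s) ` {0..dist a b} = {0..dist a b}"
    by simp
  then have "?c ` {0..dist a b} = c ` {0..dist a b}"
    by (metis (no_types) image_image)
  then have "S = ?c ` {0..dist b a}"
    using c(3) by (simp add: dist_commute)
  moreover have "\<forall>s\<in>{0..dist b a}. \<forall>t\<in>{0..dist b a}. dist (?c s) (?c t) = \<bar>s - t\<bar>"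
    using c(4) by (auto simp: dist_commute)
  ultimately show ?thesis
    unfolding geodesic_segment_def
    by (intro exI[of _ ?c]) (use c(1,2) in \<open>auto simp: dist_commute\<close>)
qed

lemma geodesic_segment_unique:
  fixes a b :: "'a::cat0_space"
  assumes S: "geodesic_segment a b S" and T: "geodesic_segment a b T"
  shows "S = T"
proof -
  have sub: "U \<subseteq> V" if U: "geodesic_segment a b U" and V: "geodesic_segment a b V" for U V
  proof
    fix x assume x: "x \<in> U"
    obtain c where c: "c 0 = a" "c (dist a b) = b" "U = c ` {0..dist a b}"
      "\<And>s t. s \<in> {0..dist a b} \<Longrightarrow> t \<in> {0..dist a b} \<Longrightarrow> dist (c s) (c t) = \<bar>s - t\<bar>"
      using U unfolding geodesic_segment_def by metis
    obtain e where e: "e 0 = a" "e (dist a b) = b" "V = e ` {0..dist a b}"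
      "\<And>s t. s \<in> {0..dist a b} \<Longrightarrow> t \<in> {0..dist a b} \<Longrightarrow> dist (e s) (e t) = \<bar>s - t\<bar>"
      using V unfolding geodesic_segment_def by metis
    obtain t where t: "t \<in> {0..dist a b}" "x = c t" using x c(3) by auto
    define y where "y = e t"
    have y: "y \<in> V" using t e(3) y_def by auto
    have "dist (c 0) (c t) = \<bar>0 - t\<bar>" "dist (e 0) (e t) = \<bar>0 - t\<bar>"
         "dist (c (dist a b)) (c t) = \<bar>dist a b - t\<bar>" "dist (e (dist a b)) (e t) = \<bar>dist a b - t\<bar>"
      using c(4) e(4) t(1) by auto
    then have d: "dist a x = t" "dist a y = t" "dist b x = dist a b - t" "dist b y = dist a b - t"
      using t c(1,2) e(1,2) y_def by auto
    define u :: "real^2" where "u = axis 1 1"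
    have u: "norm u = 1" by (simp add: u_def norm_axis_1)
    define b' where "b' = dist a b *\<^sub>R u"
    define x' where "x' = t *\<^sub>R u"
    have "x' \<in> closed_segment 0 b'"
    proof (cases "dist a b = 0")
      case True then show ?thesis using t by (simp add: x'_def b'_def)
    next
      case False
      then have "x' = (t / dist a b) *\<^sub>R b'" by (simp add: x'_def b'_def)
      then show ?thesis using t False
        by (auto simp: in_segment intro!: exI[of _ "t / dist a b"])
    qed
    moreover have nx: "norm (0 - x') = t" "norm (b' - x') = dist a b - t"
      using t u by (auto simp: x'_def b'_def simp flip: scaleR_diff_left)
    ultimately have "comparison_point a U 0 b' x x'" "comparison_point b V b' 0 y x'"
      using x y d unfolding comparison_point_def by (simp_all add: closed_segment_commute)
    then have "dist x y \<le> norm (x' - x')"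
      using u by (intro cat0_inequality[OF U geodesic_segment_singleton
            geodesic_segment_commute[OF V], of 0 b' b'])
        (auto simp: b'_def dist_commute)
    then show "x \<in> V" using y by simp
  qed
  show ?thesis using sub[OF S T] sub[OF T S] by blast
qed

lemma geodesic_segment_geodesic: "geodesic_segment a b (geodesic a b)"
  unfolding geodesic_def
  by (rule theI') (metis geodesic_space geodesic_segment_unique)

section \<open>Contracting segments and rank 1 isometries\<close>

definition nearest_points :: "'a::metric_space set \<Rightarrow> 'a \<Rightarrow> 'a set" where
  "nearest_points S x = {y \<in> S. \<forall>z\<in>S. dist x y \<le> dist x z}"

definition contracting :: "real \<Rightarrow> 'a::metric_space set \<Rightarrow> bool" where
  "contracting B S \<longleftrightarrow>
     (\<forall>x r. ball x r \<inter> S = {} \<longrightarrow> diameter (\<Union>y\<in>ball x r. nearest_points S y) < B)"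

definition hausdorff_equivalent :: "real \<Rightarrow> 'a::metric_space set \<Rightarrow> 'a set \<Rightarrow> bool" where
  "hausdorff_equivalent B S T \<longleftrightarrow> S \<subseteq> (\<Union>y\<in>T. ball y B) \<and> T \<subseteq> (\<Union>y\<in>S. ball y B)"

definition isometry :: "('a::metric_space \<Rightarrow> 'a) \<Rightarrow> bool" where
  "isometry f \<longleftrightarrow> bij f \<and> (\<forall>x y. dist (f x) (f y) = dist x y)"

definition rank1 :: "'a::cat0_space \<Rightarrow> ('a \<Rightarrow> 'a) \<Rightarrow> bool" where
  "rank1 x0 f \<longleftrightarrow> isometry f \<and>
     filterlim (\<lambda>n. dist ((f ^^ n) x0) x0) at_top sequentially \<and>
     (\<exists>B>0. \<forall>n>0.
        hausdorff_equivalent B (geodesic x0 ((f ^^ n) x0)) ((\<lambda>i. (f ^^ i) x0) ` {0..n}) \<and>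
        contracting B (geodesic x0 ((f ^^ n) x0)))"

section \<open>Groups acting by isometries\<close>

text \<open>
  The group is a type of class \<^class>\<open>group_add\<close>; it is written additively but is not assumed
  to be commutative.
\<close>

definition isometric_action :: "('g::group_add \<Rightarrow> 'a::metric_space \<Rightarrow> 'a) \<Rightarrow> bool" where
  "isometric_action \<phi> \<longleftrightarrow>
     \<phi> 0 = id \<and> (\<forall>g h. \<phi> (g + h) = \<phi> g \<circ> \<phi> h) \<and> (\<forall>g. isometry (\<phi> g))"

definition multiple :: "int \<Rightarrow> 'g::group_add \<Rightarrow> 'g" where
  "multiple n g = (if n \<ge> 0 then ((+) g ^^ nat n) 0 else ((+) (- g) ^^ nat (- n)) 0)"

definition cyclic_subgroup :: "'g::group_add \<Rightarrow> 'g set" where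
  "cyclic_subgroup g = range (\<lambda>n. multiple n g)"

text \<open>Some cyclic subgroup has finitely many left cosets; this includes all finite groups.\<close>

definition virtually_cyclic :: "'g::group_add itself \<Rightarrow> bool" where
  "virtually_cyclic _ \<longleftrightarrow> (\<exists>g::'g. finite (range (\<lambda>h. (+) h ` cyclic_subgroup g)))"

definition WPD :: "'a::cat0_space \<Rightarrow> ('g::group_add \<Rightarrow> 'a \<Rightarrow> 'a) \<Rightarrow> bool" where
  "WPD x0 \<phi> \<longleftrightarrow>
     \<not> virtually_cyclic TYPE('g) \<and>
     (\<exists>g. rank1 x0 (\<phi> g)) \<and>
     (\<forall>g. rank1 x0 (\<phi> g) \<longrightarrow>
        (\<forall>c>0. \<exists>M::nat. M > 0 \<and>
           finite {h. dist x0 (\<phi> h x0) \<le> c \<and>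
                      dist ((\<phi> g ^^ M) x0) (\<phi> h ((\<phi> g ^^ M) x0)) \<le> c}))"

section \<open>Quasi-homomorphisms\<close>

definition quasi_hom :: "('g::group_add \<Rightarrow> real) \<Rightarrow> bool" where
  "quasi_hom f \<longleftrightarrow> bdd_above (range (\<lambda>(x, y). \<bar>f (x + y) - f x - f y\<bar>))"

definition real_hom :: "('g::group_add \<Rightarrow> real) \<Rightarrow> bool" where
  "real_hom f \<longleftrightarrow> (\<forall>x y. f (x + y) = f x + f y)"

definition trivial_quasi_hom :: "('g::group_add \<Rightarrow> real) \<Rightarrow> bool" where
  "trivial_quasi_hom f \<longleftrightarrow>
     (\<exists>h b. real_hom h \<and> bounded (range b) \<and> f = (\<lambda>x. h x + b x))"

definition qh_rel :: "('g::group_add \<Rightarrow> real) \<Rightarrow> ('g \<Rightarrow> real) \<Rightarrow> bool" where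
  "qh_rel f f' \<longleftrightarrow> quasi_hom f \<and> quasi_hom f' \<and> trivial_quasi_hom (\<lambda>x. f x - f' x)"

lemma quasi_hom_iff: "quasi_hom f \<longleftrightarrow> (\<exists>C. \<forall>x y. \<bar>f (x + y) - f x - f y\<bar> \<le> C)"
  unfolding quasi_hom_def bdd_above_def by auto

lemma quasi_hom_zero: "quasi_hom (\<lambda>x. 0)"
  unfolding quasi_hom_iff by auto

lemma quasi_hom_add:
  assumes "quasi_hom f" "quasi_hom f'"
  shows "quasi_hom (\<lambda>x. f x + f' x)"
proof -
  obtain C C' where C: "\<And>x y. \<bar>f (x + y) - f x - f y\<bar> \<le> C"
    "\<And>x y. \<bar>f' (x + y) - f' x - f' y\<bar> \<le> C'"
    using assms unfolding quasi_hom_iff by metis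
  have "\<bar>(f (x + y) + f' (x + y)) - (f x + f' x) - (f y + f' y)\<bar> \<le> C + C'" for x y
    using C(1)[of x y] C(2)[of x y] by linarith
  then show ?thesis unfolding quasi_hom_iff by blast
qed

lemma quasi_hom_scale:
  assumes "quasi_hom f"
  shows "quasi_hom (\<lambda>x. r * f x)"
proof -
  obtain C where C: "\<And>x y. \<bar>f (x + y) - f x - f y\<bar> \<le> C"
    using assms unfolding quasi_hom_iff by metis
  have "\<bar>r * f (x + y) - r * f x - r * f y\<bar> \<le> \<bar>r\<bar> * C" for x y
  proof -
    have "r * f (x + y) - r * f x - r * f y = r * (f (x + y) - f x - f y)"
      by (simp add: algebra_simps)
    then show ?thesis using C[of x y] by (simp add: abs_mult mult_left_mono)
  qed
  then show ?thesis unfolding quasi_hom_iff by blast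
qed

lemma trivial_quasi_hom_iff:
  "trivial_quasi_hom f \<longleftrightarrow> (\<exists>h C. real_hom h \<and> (\<forall>x. \<bar>f x - h x\<bar> \<le> C))"
proof
  assume "trivial_quasi_hom f"
  then show "\<exists>h C. real_hom h \<and> (\<forall>x. \<bar>f x - h x\<bar> \<le> C)"
    unfolding trivial_quasi_hom_def bounded_iff by force
next
  assume "\<exists>h C. real_hom h \<and> (\<forall>x. \<bar>f x - h x\<bar> \<le> C)"
  then obtain h C where h: "real_hom h" "\<forall>x. \<bar>f x - h x\<bar> \<le> C" by blast
  have "bounded (range (\<lambda>x. f x - h x))" using h(2) unfolding bounded_iff by auto
  then show "trivial_quasi_hom f"
    unfolding trivial_quasi_hom_def using h(1)
    by (intro exI[of _ h] exI[of _ "\<lambda>x. f x - h x"]) auto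
qed

lemma trivial_quasi_hom_zero: "trivial_quasi_hom (\<lambda>x. 0)"
  unfolding trivial_quasi_hom_iff
  by (rule exI[of _ "\<lambda>x. 0"], rule exI[of _ 0]) (auto simp: real_hom_def)

lemma trivial_quasi_hom_add:
  assumes "trivial_quasi_hom f" "trivial_quasi_hom f'"
  shows "trivial_quasi_hom (\<lambda>x. f x + f' x)"
proof -
  obtain h C h' C' where h: "real_hom h" "\<And>x. \<bar>f x - h x\<bar> \<le> C"
    "real_hom h'" "\<And>x. \<bar>f' x - h' x\<bar> \<le> C'"
    using assms unfolding trivial_quasi_hom_iff by metis
  have "\<bar>(f x + f' x) - (h x + h' x)\<bar> \<le> C + C'" for x
    using h(2)[of x] h(4)[of x] by linarith
  moreover have "real_hom (\<lambda>x. h x + h' x)"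
    using h(1,3) by (auto simp: real_hom_def)
  ultimately show ?thesis unfolding trivial_quasi_hom_iff by blast
qed

lemma trivial_quasi_hom_scale:
  assumes "trivial_quasi_hom f"
  shows "trivial_quasi_hom (\<lambda>x. r * f x)"
proof -
  obtain h C where h: "real_hom h" "\<And>x. \<bar>f x - h x\<bar> \<le> C"
    using assms unfolding trivial_quasi_hom_iff by metis
  have "\<bar>r * f x - r * h x\<bar> \<le> \<bar>r\<bar> * C" for x
    using h(2)[of x] by (simp add: abs_mult mult_left_mono flip: right_diff_distrib)
  moreover have "real_hom (\<lambda>x. r * h x)"
    using h(1) by (auto simp: real_hom_def distrib_left)
  ultimately show ?thesis unfolding trivial_quasi_hom_iff by blast
qed

lemma qh_rel_refl: "qh_rel f f \<longleftrightarrow> quasi_hom f"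
  by (auto simp: qh_rel_def trivial_quasi_hom_zero)

lemma qh_rel_sym: "qh_rel f f' \<Longrightarrow> qh_rel f' f"
  using trivial_quasi_hom_scale[of "\<lambda>x. f x - f' x" "-1"] by (auto simp: qh_rel_def)

lemma qh_rel_trans: "qh_rel f f' \<Longrightarrow> qh_rel f' f'' \<Longrightarrow> qh_rel f f''"
  using trivial_quasi_hom_add[of "\<lambda>x. f x - f' x" "\<lambda>x. f' x - f'' x"] by (auto simp: qh_rel_def)

lemma qh_rel_add:
  "qh_rel f f' \<Longrightarrow> qh_rel k k' \<Longrightarrow> qh_rel (\<lambda>x. f x + k x) (\<lambda>x. f' x + k' x)"
  using trivial_quasi_hom_add[of "\<lambda>x. f x - f' x" "\<lambda>x. k x - k' x"]
  by (auto simp: qh_rel_def quasi_hom_add algebra_simps)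

lemma qh_rel_scale: "qh_rel f f' \<Longrightarrow> qh_rel (\<lambda>x. r * f x) (\<lambda>x. r * f' x)"
  using trivial_quasi_hom_scale[of "\<lambda>x. f x - f' x" r]
  by (auto simp: qh_rel_def quasi_hom_scale algebra_simps)

text \<open>
  The quotient is partial: \<^const>\<open>qh_rel\<close> is reflexive exactly on the quasi-homomorphisms,
  so its classes are the cosets \<open>f + (Hom + bounded)\<close> with \<open>f\<close> a quasi-homomorphism.
\<close>

quotient_type (overloaded) 'g qh_tilde = "'g::group_add \<Rightarrow> real" / partial: qh_rel
proof (rule part_equivpI)
  show "\<exists>f. qh_rel f f" using qh_rel_refl quasi_hom_zero by blast
  show "symp qh_rel" by (rule sympI) (rule qh_rel_sym)
  show "transp qh_rel" by (rule transpI) (rule qh_rel_trans)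
qed

instantiation qh_tilde :: (group_add) real_vector
begin

lift_definition zero_qh_tilde :: "'a qh_tilde" is "\<lambda>x. 0"
  by (simp add: qh_rel_refl quasi_hom_zero)

lift_definition plus_qh_tilde :: "'a qh_tilde \<Rightarrow> 'a qh_tilde \<Rightarrow> 'a qh_tilde"
  is "\<lambda>f k x. f x + k x"
  by (rule qh_rel_add)

lift_definition uminus_qh_tilde :: "'a qh_tilde \<Rightarrow> 'a qh_tilde" is "\<lambda>f x. - f x"
  using qh_rel_scale[where r = "-1"] by simp

lift_definition minus_qh_tilde :: "'a qh_tilde \<Rightarrow> 'a qh_tilde \<Rightarrow> 'a qh_tilde"
  is "\<lambda>f k x. f x - k x"
proof -
  fix f f' k k' :: "'a \<Rightarrow> real"
  assume "qh_rel f f'" "qh_rel k k'"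
  then show "qh_rel (\<lambda>x. f x - k x) (\<lambda>x. f' x - k' x)"
    using qh_rel_add[OF _ qh_rel_scale[where r = "-1"], of f f' k k'] by simp
qed

lift_definition scaleR_qh_tilde :: "real \<Rightarrow> 'a qh_tilde \<Rightarrow> 'a qh_tilde" is "\<lambda>r f x. r * f x"
  by (rule qh_rel_scale)

instance
proof
  fix a b c :: "'a qh_tilde" and r s :: real
  show "a + b + c = a + (b + c)"
    by transfer (simp add: add.assoc qh_rel_refl quasi_hom_add)
  show "a + b = b + a"
    by transfer (simp add: add.commute qh_rel_refl quasi_hom_add)
  show "0 + a = a" by transfer (simp add: qh_rel_refl)
  show "- a + a = 0" by transfer (simp add: qh_rel_refl quasi_hom_zero)
  show "a - b = a + - b"
    by transfer (metis (no_types, lifting) ext minus_real_def qh_rel_add qh_rel_refl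
        qh_rel_scale mult_minus1)
  show "r *\<^sub>R (a + b) = r *\<^sub>R a + r *\<^sub>R b"
    by transfer (simp add: distrib_left qh_rel_refl quasi_hom_add quasi_hom_scale)
  show "(r + s) *\<^sub>R a = r *\<^sub>R a + s *\<^sub>R a"
    by transfer (simp add: distrib_right qh_rel_refl quasi_hom_add quasi_hom_scale)
  show "r *\<^sub>R s *\<^sub>R a = (r * s) *\<^sub>R a"
    by transfer (simp add: mult.assoc qh_rel_refl quasi_hom_scale flip: mult.assoc)
  show "1 *\<^sub>R a = a" by transfer (simp add: qh_rel_refl)
qed

end

end

theory Submission
  imports Defs
begin

text \<open>
  The quasi-homomorphisms are Brooks-type counting functions: they count copies of a word along
  the way from \<open>0\<close> to \<open>h\<close>, minus the copies met on the way back.  What makes such counts work in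
  a space without any global hyperbolicity is that only pieces of contracting axes are counted.

  Let \<open>g\<close> act as a rank 1 isometry.  The orbit metric on the group, divided by the translation
  length of \<open>g\<close>, turns the powers of \<open>g\<close> into a coarse copy of the integers, and every group
  element \<open>x\<close> has a nearest index \<open>n x\<close> on it.  Contraction of the segments of the axis amounts to
  a single inequality: if \<open>n x\<close> and \<open>n y\<close> are far apart, then going from \<open>x\<close> to \<open>y\<close> costs as much
  as going to the axis, along it, and off again (\<open>both_projections_on_path\<close>, \<open>d_contraction\<close>).
  After that the space is forgotten, and the argument takes place in the group (\<open>quasi_axis\<close>).

  Let \<open>W\<close> be the set of elements with \<open>n x\<close> close to \<open>0\<close>.  The translates of \<open>W\<close> by \<open>h\<close> and by
  \<open>h + G r\<close>, with \<open>G r\<close> the \<open>r\<close>-th power of \<open>g\<close>, lie on the two sides of a segment of length \<open>r\<close>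
  on the translate of the axis by \<open>h\<close>.
  Two segments can never separate four points in two different ways (\<open>noncrossing_intervals\<close>),
  as in a tree.  Hence the greatest length of a chain of separating translates is additive along
  tripods up to a bounded error, and the antisymmetrised count is a quasi-homomorphism
  (\<open>quasi_hom_count_hom\<close>).

  Weak proper discontinuity and a pigeonhole argument show that a translate of the axis is either
  parallel to the axis or has uniformly bounded projection to it (\<open>parallel_or_bounded\<close>).  If all
  translates were parallel, the group would be virtually cyclic, so some \<open>\<gamma>\<close> moves the axis to a
  transverse one.  Then \<open>W\<close> and its translate by \<open>\<gamma>\<close> cover the group, and words that alternate
  long powers of \<open>g\<close> with \<open>\<gamma>\<close> and \<open>- \<gamma>\<close> produce chains (\<open>axis_path\<close>).

  For large \<open>\<kappa>\<close> consider the word \<open>v\<close> with exponents \<open>\<kappa>, \<kappa>, 2 \<kappa>, - 4 \<kappa>\<close> of \<open>g\<close>, and count the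
  subword with exponents \<open>2 \<kappa>, - 4 \<kappa>\<close>.  The exponents add up to zero, so all homomorphisms vanish
  on \<open>v\<close>.  The \<open>m\<close>-th power of \<open>v\<close> contains \<open>m\<close> copies (\<open>count_path_ge\<close>).  A copy met in any other
  way must have its pieces matched with pieces of the path that are at least as long, up to a
  bounded error (\<open>crossing_matches_piece\<close>).  In a reversed copy the longest piece would be followed
  along the path by one of length \<open>2 \<kappa>\<close>, but the path continues with a piece of length \<open>\<kappa>\<close>, so
  there are no reversed copies (\<open>count_reversed_zero\<close>); and a path made with
  a smaller \<open>\<kappa>\<close> contains no copy at all (\<open>count_shorter_zero\<close>).  Along a sequence of growing \<open>\<kappa>\<close>
  this is a triangular system of values, which gives linear independence modulo homomorphisms and
  bounded functions.
\<close>

section \<open>Counting chains of separating translates\<close>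

text \<open>
  Think of \<open>h + U\<close> and \<open>h + V\<close> as the near and the far side of a wall.  The condition says that the
  complement of the far side of \<open>h\<close> lies in the near side of \<open>k\<close>; since near and far sides are
  disjoint in the applications, these complements grow along a chain.
\<close>

definition precedes :: "'g::group_add set \<Rightarrow> 'g set \<Rightarrow> 'g \<Rightarrow> 'g \<Rightarrow> bool" where
  "precedes U V h k \<longleftrightarrow> (\<forall>z. - h + z \<in> V \<or> - k + z \<in> U)"

text \<open>
  The two ends are sets rather than points because a chain from \<open>x\<close> to both \<open>y\<close> and \<open>z\<close> is the
  part of a tripod that the ways from \<open>x\<close> to \<open>y\<close> and to \<open>z\<close> have in common.
\<close>

definition chain :: "'g::group_add set \<Rightarrow> 'g set \<Rightarrow> 'g set \<Rightarrow> 'g set \<Rightarrow> 'g list \<Rightarrow> bool" where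
  "chain U V A B hs \<longleftrightarrow> sorted_wrt (precedes U V) hs \<and>
     (\<forall>h\<in>set hs. (\<forall>x\<in>A. - h + x \<in> U) \<and> (\<forall>y\<in>B. - h + y \<in> V))"

definition chain_count :: "'g::group_add set \<Rightarrow> 'g set \<Rightarrow> 'g set \<Rightarrow> 'g set \<Rightarrow> nat" where
  "chain_count U V A B = Max (length ` {hs. chain U V A B hs})"

text \<open>
  The assumption \<open>noncrossing\<close> forbids that all four intersections of a side of one translate with
  a side of another one are inhabited, which is how the half-spaces of a tree behave.
\<close>

locale separating_pair =
  fixes U V :: "'g::group_add set"
  assumes noncrossing:
    "\<lbrakk>- h + x \<in> U; - h + u \<in> U; - h + y \<in> V; - h + z \<in> V;
      - k + x \<in> U; - k + u \<in> V; - k + y \<in> V; - k + z \<in> U\<rbrakk> \<Longrightarrow> False"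
  and chain_bounded: "\<exists>n. \<forall>hs. chain U V {x} {y} hs \<longrightarrow> length hs \<le> n"
begin

abbreviation "N \<equiv> chain_count U V"

lemma finite_lengths:
  assumes "A \<noteq> {}" "B \<noteq> {}"
  shows "finite (length ` {hs. chain U V A B hs})"
proof -
  obtain x y where xy: "x \<in> A" "y \<in> B" using assms by blast
  obtain n where "\<And>hs. chain U V {x} {y} hs \<Longrightarrow> length hs \<le> n"
    using chain_bounded[of x y] by blast
  moreover have "chain U V {x} {y} hs" if "chain U V A B hs" for hs
    using that xy unfolding chain_def by blast
  ultimately have "length ` {hs. chain U V A B hs} \<subseteq> {..n}" by fastforce
  then show ?thesis using finite_subset by blast
qed

lemma chain_Nil: "chain U V A B []"
  by (simp add: chain_def)

lemma length_le_count:
  assumes "A \<noteq> {}" "B \<noteq> {}" "chain U V A B hs"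
  shows "length hs \<le> N A B"
  unfolding chain_count_def using finite_lengths assms by (intro Max_ge) auto

lemma count_attained:
  assumes "A \<noteq> {}" "B \<noteq> {}"
  obtains hs where "chain U V A B hs" "length hs = N A B"
proof -
  have "length ` {hs. chain U V A B hs} \<noteq> {}" using chain_Nil by blast
  from Max_in[OF finite_lengths[OF assms] this] show ?thesis
    using that unfolding chain_count_def by auto
qed

text \<open>
  The third point \<open>z\<close> cuts a longest chain: let \<open>h\<close> be the first link that does not have \<open>z\<close> on
  its far side.  The links before \<open>h\<close> have both \<open>y\<close> and \<open>z\<close> on their far side, and those after
  \<open>h\<close> have both \<open>x\<close> and \<open>z\<close> on their near side.
\<close>

lemma count_upper: "N {x} {y} \<le> N {x} {y, z} + N {x, z} {y} + 1"
proof -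
  obtain hs where hs: "chain U V {x} {y} hs" "length hs = N {x} {y}"
    by (rule count_attained[of "{x}" "{y}"]) auto
  define as where "as = takeWhile (\<lambda>h. - h + z \<in> V) hs"
  define bs where "bs = dropWhile (\<lambda>h. - h + z \<in> V) hs"
  have split: "hs = as @ bs" by (simp add: as_def bs_def)
  have "\<forall>h\<in>set as. - h + z \<in> V" by (auto simp: as_def dest: set_takeWhileD)
  then have "chain U V {x} {y, z} as"
    using hs(1) split by (auto simp: chain_def sorted_wrt_append)
  then have as: "length as \<le> N {x} {y, z}" by (intro length_le_count) auto
  have "length bs \<le> N {x, z} {y} + 1"
  proof (cases bs)
    case (Cons b cs)
    have "- b + z \<notin> V" using Cons hd_dropWhile[of "\<lambda>h. - h + z \<in> V" hs] by (auto simp: bs_def)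
    then have "\<forall>h\<in>set cs. - h + z \<in> U"
      using hs(1) split Cons by (auto simp: chain_def sorted_wrt_append precedes_def)
    then have "chain U V {x, z} {y} cs"
      using hs(1) split Cons by (auto simp: chain_def sorted_wrt_append)
    then have "length cs \<le> N {x, z} {y}" by (intro length_le_count) auto
    then show ?thesis using Cons by simp
  qed simp
  then show ?thesis using as hs(2) split by simp
qed

text \<open>
  Conversely a chain towards \<open>y\<close> and \<open>z\<close> can be continued by a chain away from \<open>x\<close> and \<open>z\<close>, after
  the last link \<open>a\<close> of the first and the first link \<open>b\<close> of the second are dropped.  A point that
  violates the relation at the junction would lie on the near side of \<open>a\<close> and the far side of \<open>b\<close>,
  and with \<open>x\<close>, \<open>y\<close>, \<open>z\<close> it would make \<open>a\<close> and \<open>b\<close> cross.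
\<close>

lemma count_lower: "N {x} {y, z} + N {x, z} {y} \<le> N {x} {y} + 2"
proof -
  obtain as where as: "chain U V {x} {y, z} as" "length as = N {x} {y, z}"
    by (rule count_attained[of "{x}" "{y, z}"]) auto
  obtain bs where bs: "chain U V {x, z} {y} bs" "length bs = N {x, z} {y}"
    by (rule count_attained[of "{x, z}" "{y}"]) auto
  have le: "length (butlast as @ tl bs) \<le> N {x} {y}"
  proof (rule length_le_count)
    have "precedes U V h k" if h: "h \<in> set (butlast as)" and k: "k \<in> set (tl bs)" for h k
    proof -
      define a where "a = last as"
      define b where "b = hd bs"
      have as': "as = butlast as @ [a]" using h by (cases as rule: rev_cases) (auto simp: a_def)
      have bs': "bs = b # tl bs" using k by (cases bs) (auto simp: b_def)
      have ha: "precedes U V h a"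
        using as(1) h by (subst (asm) as') (auto simp: chain_def sorted_wrt_append)
      have bk: "precedes U V b k"
        using bs(1) k by (subst (asm) bs') (auto simp: chain_def)
      have ma: "a \<in> set as" by (subst as') simp
      have mb: "b \<in> set bs" by (subst bs') simp
      show ?thesis
        unfolding precedes_def
      proof (rule allI, rule ccontr)
        fix u assume "\<not> (- h + u \<in> V \<or> - k + u \<in> U)"
        then have "- a + u \<in> U" "- b + u \<in> V"
          using ha bk unfolding precedes_def by blast+
        then show False
          using noncrossing[of a x u y z b] as(1) bs(1) ma mb unfolding chain_def by blast
      qed
    qed
    moreover have "sorted_wrt (precedes U V) (butlast as)"
      using as(1) by (cases as rule: rev_cases) (auto simp: chain_def sorted_wrt_append)
    moreover have "sorted_wrt (precedes U V) (tl bs)"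
      using bs(1) by (cases bs) (auto simp: chain_def)
    moreover have "set (butlast as) \<subseteq> set as" "set (tl bs) \<subseteq> set bs"
      by (auto dest: in_set_butlastD) (metis list.sel(2) list.set_sel(2))
    ultimately show "chain U V {x} {y} (butlast as @ tl bs)"
      using as(1) bs(1) unfolding chain_def by (auto simp: sorted_wrt_append subset_iff)
  qed auto
  then show ?thesis using as(2) bs(2) by simp
qed

lemma chain_translate:
  assumes "chain U V {x} {y} hs"
  shows "chain U V {g + x} {g + y} (map ((+) g) hs)"
proof -
  have *: "- (g + h) + z = - h + (- g + z)" for h z
    by (simp add: minus_add add.assoc del: add_uminus_conv_diff)
  have "- (g + h) + (g + z) = - h + z" for h z
    unfolding * by (simp add: add.assoc[symmetric])
  moreover have "precedes U V (g + h) (g + k)" if "precedes U V h k" for h k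
    using that unfolding precedes_def * by blast
  ultimately show ?thesis using assms
    by (auto simp: chain_def sorted_wrt_map elim!: sorted_wrt_mono_rel[rotated])
qed

lemma count_translate: "N {g + x} {g + y} = N {x} {y}"
proof -
  have le: "N {x} {y} \<le> N {h + x} {h + y}" for x y h
  proof -
    obtain hs where hs: "chain U V {x} {y} hs" "length hs = N {x} {y}"
      by (rule count_attained[of "{x}" "{y}"]) auto
    show ?thesis
      using length_le_count[OF _ _ chain_translate[OF hs(1), of h]] hs(2) by simp
  qed
  show ?thesis
    using le[of x y g] le[of "g + x" "g + y" "- g"] by (simp add: add.assoc[symmetric])
qed

definition count_hom :: "'g \<Rightarrow> real" where
  "count_hom h = real (N {0} {h}) - real (N {h} {0})"

text \<open>
  For a triangle with corners \<open>0\<close>, \<open>a\<close>, \<open>a + b\<close>, the two preceding inequalities express each of the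
  six counts, up to a bounded error, by counts from one corner to the other two or from two
  corners to the third.  Both cyclic orders give the same total.
\<close>

theorem quasi_hom_count_hom: "quasi_hom count_hom"
  unfolding quasi_hom_iff
proof (intro exI allI)
  fix a b :: 'g
  let ?x = 0 and ?y = a and ?z = "a + b"
  have tr: "N {0} {b} = N {?y} {?z}" "N {b} {0} = N {?z} {?y}"
    using count_translate[of a 0 b] count_translate[of a b 0] by simp_all
  show "\<bar>count_hom (a + b) - count_hom a - count_hom b\<bar> \<le> 9"
    unfolding count_hom_def tr
    using count_upper[of ?x ?y ?z] count_lower[of ?x ?y ?z]
      count_upper[of ?y ?x ?z] count_lower[of ?y ?x ?z]
      count_upper[of ?x ?z ?y] count_lower[of ?x ?z ?y]
      count_upper[of ?z ?x ?y] count_lower[of ?z ?x ?y]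
      count_upper[of ?y ?z ?x] count_lower[of ?y ?z ?x]
      count_upper[of ?z ?y ?x] count_lower[of ?z ?y ?x]
    by (simp add: insert_commute)
qed

end

section \<open>Coarse geometry of a contracting axis\<close>

text \<open>
  The group with a left-invariant pseudometric of which \<open>nu\<close> is the length function, a coarsely
  isometric copy \<open>G\<close> of the integers, and a nearest-index map \<open>n\<close> that is exactly equivariant under
  \<open>G\<close>.  The assumption \<open>contraction\<close> is all that remains of the geometry of the space.
\<close>

locale quasi_axis =
  fixes nu :: "'g::group_add \<Rightarrow> real" and G :: "int \<Rightarrow> 'g" and n :: "'g \<Rightarrow> int" and K :: real
  assumes nu_zero: "nu 0 = 0"
    and nu_minus: "nu (- x) = nu x"
    and nu_add: "nu (x + y) \<le> nu x + nu y"
    and G_add: "G (i + j) = G i + G j"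
    and nu_G: "\<bar>nu (G i) - \<bar>real_of_int i\<bar>\<bar> \<le> K"
    and nearest: "nu (- x + G (n x)) \<le> nu (- x + G i)"
    and n_G_add: "n (G i + x) = i + n x"
    and K_pos: "K > 0"
    and contraction: "\<bar>real_of_int (n x - n y)\<bar> > K \<Longrightarrow>
      nu (- x + G (n x)) + \<bar>real_of_int (n x - n y)\<bar> + nu (- y + G (n y)) \<le> nu (- x + y) + K"
begin

definition D :: "'g \<Rightarrow> 'g \<Rightarrow> real" where "D x y = nu (- x + y)"

abbreviation gap :: "'g \<Rightarrow> 'g \<Rightarrow> real" where
  "gap x y \<equiv> \<bar>real_of_int (n x) - real_of_int (n y)\<bar>"

lemma G_zero: "G 0 = 0"
  using G_add[of 0 0] by (metis add.right_neutral add_left_cancel add_0)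

lemma G_minus: "G (- i) = - G i"
  using G_add[of "- i" i] G_zero by (simp add: eq_neg_iff_add_eq_0)

lemma D_translate: "D (h + x) (h + y) = D x y"
  unfolding D_def by (simp add: minus_add add.assoc del: add_uminus_conv_diff)

lemma D_shift: "D (- h + x) y = D x (h + y)" "D x (- h + y) = D (h + x) y"
  using D_translate[of h "- h + x" y] D_translate[of h x "- h + y"]
  by (simp_all add: add.assoc[symmetric])

lemma D_self: "D x x = 0"
  by (simp add: D_def nu_zero)

lemma D_sym: "D x y = D y x"
  using nu_minus[of "- x + y"] unfolding D_def by (simp add: minus_add del: add_uminus_conv_diff)

lemma D_triangle: "D x z \<le> D x y + D y z"
  using nu_add[of "- x + y" "- y + z"] unfolding D_def
  by (simp add: add.assoc del: add_uminus_conv_diff)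

lemma D_nonneg: "0 \<le> D x y"
  using D_triangle[of x x y] D_self[of x] D_sym[of x y] by linarith

lemma D_zero: "D 0 x = nu x"
  by (simp add: D_def)

lemma D_add_right: "D x (x + y) = nu y"
  unfolding D_def by (simp add: add.assoc[symmetric])

lemma D_G: "\<bar>D (G i) (G j) - \<bar>real_of_int i - real_of_int j\<bar>\<bar> \<le> K"
  using nu_G[of "j - i"] unfolding D_def
  by (simp add: G_minus[symmetric] G_add[symmetric] abs_minus_commute)

definition dist_axis :: "'g \<Rightarrow> real" where "dist_axis x = D x (G (n x))"

lemma dist_axis_le: "dist_axis x \<le> D x (G i)"
  unfolding dist_axis_def D_def by (rule nearest)

lemma D_contraction: "gap x y > K \<Longrightarrow> dist_axis x + gap x y + dist_axis y \<le> D x y + K"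
  using contraction[of x y] unfolding dist_axis_def D_def by simp

lemma dist_axis_nonneg: "0 \<le> dist_axis x"
  unfolding dist_axis_def by (rule D_nonneg)

lemma dist_axis_triangle: "dist_axis x \<le> D x y + dist_axis y"
  using dist_axis_le[of x "n y"] D_triangle[of x "G (n y)" y] unfolding dist_axis_def by linarith

lemma n_zero_le: "\<bar>real_of_int (n 0)\<bar> \<le> K"
proof -
  have "D 0 (G (n 0)) \<le> 0"
    using dist_axis_le[of 0 0] by (simp add: dist_axis_def G_zero D_self)
  then show ?thesis using nu_G[of "n 0"] D_nonneg[of 0 "G (n 0)"] by (simp add: D_zero)
qed

lemma n_G: "n (G i) = i + n 0"
  using n_G_add[of i 0] by simp

lemma gap_le_D: "gap x y \<le> D x y + K"
  using D_contraction[of x y] dist_axis_nonneg[of x] dist_axis_nonneg[of y] D_nonneg[of x y]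
  by linarith

text \<open>
  The contraction inequality with one point on the axis; when the two indices are close, it holds
  because \<open>dist_axis\<close> is a minimum.
\<close>

lemma near_axis: "dist_axis x + \<bar>real_of_int (n x) - real_of_int i\<bar> \<le> D x (G i) + 2 * K"
proof -
  have "dist_axis x + gap x (G i) \<le> D x (G i) + K"
    using D_contraction[of x "G i"] dist_axis_nonneg[of "G i"] dist_axis_le[of x i] by linarith
  then show ?thesis using n_zero_le n_G[of i] by simp
qed

lemma D_projections: "D x y \<le> dist_axis x + gap x y + K + dist_axis y"
  using D_triangle[of x y "G (n x)"] D_triangle[of "G (n x)" y "G (n y)"]
    D_G[of "n x" "n y"] D_sym[of y "G (n y)"]
  unfolding dist_axis_def by linarith

lemma passes_between:
  assumes "gap x y > K"
    and "\<bar>real_of_int (n x) - real_of_int i\<bar> + \<bar>real_of_int i - real_of_int (n y)\<bar> = gap x y"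
  shows "D x (G i) + D (G i) y \<le> D x y + 3 * K"
  using D_contraction[OF assms(1)] assms(2) D_triangle[of x "G i" "G (n x)"]
    D_triangle[of "G i" y "G (n y)"] D_G[of "n x" i] D_G[of i "n y"] D_sym[of y "G (n y)"]
  unfolding dist_axis_def by linarith

text \<open>
  Coarse betweenness survives the projection to the axis.  If \<open>m\<close> projects far from both \<open>p\<close> and
  \<open>q\<close>, then the contraction inequality applies to both halves of the way from \<open>p\<close> to \<open>q\<close>, and any
  detour of the indices would be a detour in the group.
\<close>

lemma projection_between:
  assumes "D p m + D m q \<le> D p q + C" "C \<ge> 0"
  shows "gap p m + gap m q \<le> gap p q + C + 3 * K"
proof (cases "gap p m > K \<and> gap m q > K")
  case True
  then show ?thesis
    using D_contraction[of p m] D_contraction[of m q] D_projections[of p q] assms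
      dist_axis_nonneg[of m] by linarith
next
  case False
  then show ?thesis using assms(2) K_pos by linarith
qed

lemma quasiconvex:
  assumes "D (G i) b + D b (G j) \<le> D (G i) (G j) + 3 * K"
  shows "dist_axis b \<le> 4 * K"
  using near_axis[of b i] near_axis[of b j] assms D_G[of i j] D_sym[of b "G i"] by linarith

text \<open>
  The Behrstock inequality for the axis and its translate by \<open>f\<close>: if \<open>x\<close> projects to the translate
  far from the projection of the axis, then the way from \<open>x\<close> to its projection to the axis enters
  the translate, whose points all have the same coarse projection to the axis.
\<close>

lemma behrstock:
  assumes "\<And>i j. gap (f + G i) (f + G j) \<le> C" "\<And>i j. gap (- f + G i) (- f + G j) \<le> C"
  shows "gap x f \<le> C + 7 * K \<or> gap (- f + x) (- f) \<le> C + 7 * K"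
proof (rule ccontr)
  assume neg: "\<not> ?thesis"
  define i where "i = n x"
  define k where "k = n (- f + G i)"
  have C: "C \<ge> 0" using assms(1)[of 0 0] by simp
  have "gap (- f + G i) (- f) \<le> C" using assms(2)[of i 0] by (simp add: G_zero)
  then have "gap (- f + x) (- f + G i) > K" using neg K_pos by linarith
  then have "D (- f + x) (G k) + D (G k) (- f + G i) \<le> D (- f + x) (- f + G i) + 3 * K"
    by (rule passes_between) (simp add: k_def)
  then have "D x (f + G k) + D (f + G k) (G i) \<le> D x (G i) + 3 * K"
    by (simp add: D_shift D_translate add.assoc[symmetric])
  from projection_between[OF this] have "gap x (f + G k) \<le> gap x (G i) + 6 * K"
    using K_pos by linarith
  moreover have "gap x (G i) \<le> K" using n_zero_le n_G[of i] by (simp add: i_def)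
  moreover have "gap (f + G k) f \<le> C" using assms(1)[of k 0] by (simp add: G_zero)
  ultimately show False using neg by linarith
qed

text \<open>
  If the projection of the translate is long, then \<open>G t\<close> is coarsely between two points of the
  translate, which is quasiconvex.
\<close>

lemma tracked:
  assumes "gap (h + G i) (h + G j) > K"
    and "n (h + G i) \<le> t \<and> t \<le> n (h + G j) \<or> n (h + G j) \<le> t \<and> t \<le> n (h + G i)"
  shows "dist_axis (- h + G t) \<le> 4 * K"
proof (rule quasiconvex)
  have "D (h + G i) (G t) + D (G t) (h + G j) \<le> D (h + G i) (h + G j) + 3 * K"
    using assms by (intro passes_between) auto
  then show "D (G i) (- h + G t) + D (- h + G t) (G j) \<le> D (G i) (G j) + 3 * K"
    by (simp add: D_shift D_translate)
qed

text \<open>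
  On parallel translates the two nearest-point projections coincide up to a bounded error.
\<close>

definition parallel :: "'g \<Rightarrow> bool" where
  "parallel h \<longleftrightarrow> (\<forall>x. D (G (n x)) (h + G (n (- h + x))) \<le> 15 * K)"

lemma parallel_minus: "parallel h \<Longrightarrow> parallel (- h)"
  unfolding parallel_def
proof
  fix x assume "\<forall>x. D (G (n x)) (h + G (n (- h + x))) \<le> 15 * K"
  then have "D (G (n (h + x))) (h + G (n (- h + (h + x)))) \<le> 15 * K" by blast
  then show "D (G (n x)) (- h + G (n (- (- h) + x))) \<le> 15 * K"
    by (simp add: D_shift D_sym add.assoc[symmetric])
qed

text \<open>
  Two coarse lines, each close to the other, have the same coarse nearest-point projection, because
  a nearly nearest point is close to the nearest one (\<open>near_axis\<close>).
\<close>

lemma parallelI: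
  assumes "\<And>t. dist_axis (h + G t) \<le> 4 * K" "\<And>t. dist_axis (- h + G t) \<le> 4 * K"
  shows "parallel h"
  unfolding parallel_def
proof
  fix x
  define s where "s = n (- h + G (n x))"
  define k where "k = n (- h + x)"
  have s: "D (G (n x)) (h + G s) \<le> 4 * K"
    using assms(2)[of "n x"] unfolding dist_axis_def s_def D_shift .
  have "D (- h + x) (G s) \<le> dist_axis x + 4 * K"
    using D_triangle[of x "h + G s" "G (n x)"] s unfolding D_shift dist_axis_def by linarith
  moreover have "dist_axis x \<le> dist_axis (- h + x) + 4 * K"
    using dist_axis_triangle[of x "h + G k"] assms(1)[of k]
    unfolding dist_axis_def[of "- h + x"] k_def D_shift by linarith
  ultimately have "\<bar>real_of_int k - real_of_int s\<bar> \<le> 10 * K"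
    using near_axis[of "- h + x" s] unfolding k_def by linarith
  then have "D (h + G s) (h + G k) \<le> 11 * K"
    unfolding D_translate using D_G[of s k] by linarith
  then show "D (G (n x)) (h + G (n (- h + x))) \<le> 15 * K"
    using s D_triangle[of "G (n x)" "h + G k" "h + G s"] unfolding k_def by linarith
qed

lemma G_scale:
  assumes "f + G a = G b + f"
  shows "f + G (int k * a) = G (int k * b) + f"
proof (induction k)
  case 0 then show ?case by (simp add: G_zero)
next
  case (Suc k)
  have "f + G (int (Suc k) * a) = f + G a + G (int k * a)"
    by (simp add: distrib_right add.assoc G_add)
  also have "\<dots> = G b + (f + G (int k * a))" using assms by (simp add: add.assoc)
  also have "\<dots> = G (int (Suc k) * b) + f"
    unfolding Suc by (simp add: distrib_right add.assoc[symmetric] G_add)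
  finally show ?case .
qed

text \<open>
  Conjugating by \<open>f\<close> carries a power of \<open>g\<close> to a power of \<open>g\<close>, so the projection of the translate
  to the axis is unbounded in both directions and \<open>tracked\<close> applies to every point of the axis.
\<close>

lemma commensurating_tracked:
  assumes "f + G a = G b + f" "b \<noteq> 0"
  shows "dist_axis (- f + G t) \<le> 4 * K"
proof -
  define N where "N = nat \<lceil>K + 1\<rceil> + nat \<bar>t - n f\<bar>"
  have eq: "n (f + G (int k * a)) = int k * b + n f" for k
    using G_scale[OF assms(1), of k] n_G_add by simp
  have eq': "n (f + G (int k * (- a))) = int k * (- b) + n f" for k
  proof -
    have "f + G (- a) = G (- b) + f"
    proof -
      have "G (- b) + ((f + G a) + G (- a)) = G (- b) + ((G b + f) + G (- a))" using assms(1) by simp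
      moreover have "G (- b) + ((f + G a) + G (- a)) = G (- b) + (f + (G a + G (- a)))"
        by (simp only: add.assoc)
      moreover have "G (- b) + ((G b + f) + G (- a)) = (G (- b) + G b) + (f + G (- a))"
        by (simp only: add.assoc)
      ultimately show ?thesis by (simp add: G_add[symmetric] G_zero)
    qed
    from G_scale[OF this, of k] show ?thesis using n_G_add by simp
  qed
  have N: "real N > K" "int N \<ge> \<bar>t - n f\<bar>"
    unfolding N_def using K_pos by (simp_all) linarith
  have Nb: "int N \<le> \<bar>int N * b\<bar>"
    using assms(2) mult_left_mono[of 1 "\<bar>b\<bar>" "int N"] by (simp add: abs_mult)
  show ?thesis
  proof (rule tracked[of f "int N * a" "int N * (- a)"])
    define r where "r = int N * b"
    have "int N \<le> \<bar>r\<bar>" using Nb by (simp add: r_def)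
    then have "real N \<le> \<bar>real_of_int r\<bar>" by linarith
    then show "gap (f + G (int N * a)) (f + G (int N * - a)) > K"
      unfolding eq eq' unfolding mult_minus_right r_def[symmetric] using N(1) K_pos by linarith
    show "n (f + G (int N * a)) \<le> t \<and> t \<le> n (f + G (int N * - a)) \<or>
          n (f + G (int N * - a)) \<le> t \<and> t \<le> n (f + G (int N * a))"
      unfolding eq eq' using N(2) Nb by linarith
  qed
qed

text \<open>
  The exponent \<open>b\<close> cannot vanish: all multiples of \<open>a\<close> would then be exponents of the identity,
  contradicting \<open>nu_G\<close>.
\<close>

lemma commensurating_parallel:
  assumes "f + G a = G b + f" "a \<noteq> 0"
  shows "parallel (- f)"
proof -
  have b: "b \<noteq> 0"
  proof
    assume "b = 0"
    define k where "k = nat \<lceil>K\<rceil> + 1"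
    have k: "real k > K" unfolding k_def by linarith
    have "f + G (int k * a) = f" using G_scale[OF assms(1), of k] \<open>b = 0\<close> by (simp add: G_zero)
    then have "G (int k * a) = 0" by (metis add.right_neutral add_left_cancel)
    then have "\<bar>real k * real_of_int a\<bar> \<le> K" using nu_G[of "int k * a"] nu_zero by simp
    moreover have "real k * 1 \<le> \<bar>real k * real_of_int a\<bar>"
      using assms(2) unfolding abs_mult by (intro mult_mono) auto
    ultimately show False using k by simp
  qed
  have "- f + G b = G a + - f"
    using arg_cong[OF assms(1), of "\<lambda>z. - f + z + - f"]
    by (simp add: add.assoc del: add_uminus_conv_diff)
  from commensurating_tracked[OF this assms(2)]
  show ?thesis using commensurating_tracked[OF assms(1) b] by (intro parallelI) auto
qed

end

section \<open>Weak proper discontinuity along the axis\<close>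

locale wpd_axis = quasi_axis +
  assumes wpd: "c > 0 \<Longrightarrow> \<exists>M>0. finite {h. nu h \<le> c \<and> nu (- G M + h + G M) \<le> c}"
begin

text \<open>
  If the axis, moved by \<open>f\<close>, is close to the axis at two places at distance \<open>M\<close>, then the error
  \<open>e\<close> in replacing \<open>f + G t\<close> by the nearest point of the axis moves both \<open>0\<close> and \<open>G M\<close> little, up
  to a reversal of direction.  Such elements are finite in number by weak proper discontinuity;
  those which reverse the direction form part of a single coset of the others.
\<close>

lemma finite_fractional_parts:
  assumes "c \<ge> 0"
  obtains M F where "M > 0" "finite F"
    "\<And>f t. dist_axis (f + G t) \<le> c \<Longrightarrow> dist_axis (f + G (t + M)) \<le> c \<Longrightarrow>
       - G (n (f + G t)) + (f + G t) \<in> F"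
proof -
  define c' where "c' = 6 * c + 8 * K"
  obtain M where M: "M > 0" "finite {h. nu h \<le> c' \<and> nu (- G M + h + G M) \<le> c'}"
    using wpd[of c'] assms K_pos unfolding c'_def by auto
  define S where "S = {h. nu h \<le> c' \<and> D (G M) (h + G M) \<le> c'}"
  have finS: "finite S" using M(2) unfolding S_def D_def by (simp add: add.assoc)
  define Q where "Q j = {e. nu e \<le> c \<and> D (G j) (e + G M) \<le> 3 * c + 4 * K}" for j
  have finQ: "finite (Q j)" for j
  proof (cases "Q j = {}")
    case False
    then obtain e0 where e0: "e0 \<in> Q j" by blast
    \<comment> \<open>Two errors with the same direction differ by an element that moves both points little.\<close>
    have "e \<in> (+) e0 ` S" if e: "e \<in> Q j" for e
    proof (rule image_eqI)
      show "e = e0 + (- e0 + e)" by (simp add: add.assoc[symmetric])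
      have "nu (- e0 + e) \<le> c'"
        using nu_add[of "- e0" e] nu_minus[of e0] e e0 assms K_pos unfolding Q_def c'_def by simp
      moreover have "D (G M) (- e0 + e + G M) \<le> c'"
        using D_triangle[of "e0 + G M" "e + G M" "G j"] D_sym[of "e0 + G M" "G j"] e e0
        unfolding Q_def c'_def by (simp add: D_shift add.assoc)
      ultimately show "- e0 + e \<in> S" unfolding S_def by simp
    qed
    then show ?thesis using finS by (meson finite_imageI finite_subset subsetI)
  qed simp
  show thesis
  proof (rule that[OF M(1)])
    show "finite (Q M \<union> Q (- M))" using finQ by simp
    fix f t assume ft: "dist_axis (f + G t) \<le> c" "dist_axis (f + G (t + M)) \<le> c"
    define a where "a = n (f + G t)"
    define b where "b = n (f + G (t + M))"
    define e where "e = - G a + (f + G t)"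
    have nue: "nu e \<le> c"
      using ft(1) unfolding D_sym[of "f + G t"] dist_axis_def a_def[symmetric]
      by (simp add: e_def D_def)
    have "e + G M = - G a + (f + G (t + M))"
      unfolding e_def by (simp add: G_add add.assoc)
    then have eM: "D (G (b - a)) (e + G M) \<le> c"
      using ft(2) D_sym[of "f + G (t + M)" "G b"] G_add[of a "b - a"]
      unfolding dist_axis_def b_def by (simp add: D_shift(2))
    have "\<bar>D (f + G t) (f + G (t + M)) - real_of_int M\<bar> \<le> K"
      unfolding D_translate using D_G[of t "t + M"] M(1) by simp
    then have ab: "\<bar>\<bar>real_of_int b - real_of_int a\<bar> - real_of_int M\<bar> \<le> 2 * c + 2 * K"
      using ft gap_le_D[of "f + G t" "f + G (t + M)"] D_projections[of "f + G t" "f + G (t + M)"]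
        assms K_pos
      unfolding a_def b_def by linarith
    show "e \<in> Q M \<union> Q (- M)"
    proof (cases "b \<ge> a")
      case True
      then have "D (G M) (G (b - a)) \<le> 2 * c + 3 * K" using D_G[of M "b - a"] ab by simp
      then show ?thesis using nue eM D_triangle[of "G M" "e + G M" "G (b - a)"] K_pos
        unfolding Q_def by simp
    next
      case False
      then have "D (G (- M)) (G (b - a)) \<le> 2 * c + 3 * K" using D_G[of "- M" "b - a"] ab by simp
      then show ?thesis using nue eM D_triangle[of "G (- M)" "e + G M" "G (b - a)"] K_pos
        unfolding Q_def by simp
    qed
  qed
qed

text \<open>
  If the projection of a translate is long, then many integers \<open>t\<close> have errors in the finite set of
  \<open>finite_fractional_parts\<close>.  Two of the errors coincide, and this is an equation between a
  conjugate of a power of \<open>g\<close> and a power of \<open>g\<close>.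
\<close>

lemma parallel_or_bounded:
  obtains C where "\<And>h. parallel h \<or> (\<forall>i j. gap (h + G i) (h + G j) \<le> C)"
proof -
  have "4 * K \<ge> 0" using K_pos by simp
  from finite_fractional_parts[OF this] obtain M F where MF: "M > 0" "finite F"
    "\<And>f t. dist_axis (f + G t) \<le> 4 * K \<Longrightarrow> dist_axis (f + G (t + M)) \<le> 4 * K \<Longrightarrow>
       - G (n (f + G t)) + (f + G t) \<in> F" by metis
  define C where "C = K + real_of_int M + real (card F)"
  have "parallel h" if "gap (h + G i) (h + G j) > C" for h i j
  proof -
    define f where "f = - h"
    have K: "gap (h + G i) (h + G j) > K" using that MF(1) unfolding C_def by simp
    define t0 where "t0 = min (n (h + G i)) (n (h + G j))"
    define t1 where "t1 = max (n (h + G i)) (n (h + G j))"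
    have tr: "dist_axis (f + G t) \<le> 4 * K" if "t0 \<le> t" "t \<le> t1" for t
      unfolding f_def using that by (intro tracked[OF K]) (auto simp: t0_def t1_def)
    define e where "e t = - G (n (f + G t)) + (f + G t)" for t
    have "e ` {t0..t1 - M} \<subseteq> F"
      using MF(1) unfolding e_def by (auto intro!: MF(3) tr)
    moreover have "card {t0..t1 - M} > card F"
    proof -
      have "real_of_int (t1 - t0) = gap (h + G i) (h + G j)"
        unfolding t0_def t1_def by (simp add: max_def min_def)
      then have "real_of_int (t1 - t0) > real_of_int (M + int (card F))"
        using that K_pos unfolding C_def by simp
      then have "t1 - t0 > M + int (card F)" by linarith
      then show ?thesis by simp
    qed
    ultimately have "\<not> inj_on e {t0..t1 - M}"
      using MF(2) by (metis card_mono card_image leD)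
    then obtain t s where ts: "e t = e s" "t \<noteq> s" unfolding inj_on_def by blast
    have et: "f + G t = G (n (f + G t)) + e t" for t
      unfolding e_def by (simp add: add.assoc[symmetric])
    define a where "a = n (f + G t)"
    define b where "b = n (f + G s)"
    have "G (- b) + (f + G s) = G (- a) + (f + G t)"
      using ts(1) unfolding e_def a_def b_def G_minus by simp
    then have eq: "G a + ((G (- b) + (f + G s)) + G (- s)) = G a + ((G (- a) + (f + G t)) + G (- s))"
      by simp
    have "G a + ((G (- b) + (f + G s)) + G (- s)) = (G a + G (- b)) + (f + (G s + G (- s)))"
      by (simp only: add.assoc)
    moreover have "G a + ((G (- a) + (f + G t)) + G (- s)) = (G a + G (- a)) + (f + (G t + G (- s)))"
      by (simp only: add.assoc)
    ultimately have "G (a - b) + f = f + G (t - s)"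
      using eq by (simp add: G_add[symmetric] G_zero)
    then have "parallel (- f)"
      using ts(2) by (intro commensurating_parallel[of _ "t - s" "a - b"]) auto
    then show ?thesis by (simp add: f_def)
  qed
  then show thesis using that[of C] not_le by blast
qed

text \<open>
  When every translate is close to the axis, the error of \<open>- h\<close> always lies in one finite set, so
  \<open>h\<close> is a power of \<open>g\<close> up to finitely many left cosets.
\<close>

lemma all_parallel_finite_cosets:
  assumes "\<And>h. parallel h"
  shows "finite (range (\<lambda>h. (+) h ` range G))"
proof -
  have "15 * K \<ge> 0" using K_pos by simp
  from finite_fractional_parts[OF this] obtain M F where MF: "M > 0" "finite F"
    "\<And>f t. dist_axis (f + G t) \<le> 15 * K \<Longrightarrow> dist_axis (f + G (t + M)) \<le> 15 * K \<Longrightarrow>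
       - G (n (f + G t)) + (f + G t) \<in> F" by metis
  have near: "dist_axis (f + G t) \<le> 15 * K" for f t
  proof -
    define s where "s = t - n 0"
    have "D (G (n (f + G s))) (f + G (n (- f + (f + G s)))) \<le> 15 * K"
      using assms unfolding parallel_def by blast
    moreover have "n (- f + (f + G s)) = t" by (simp add: s_def n_G add.assoc[symmetric])
    ultimately have "D (G (n (f + G s))) (f + G t) \<le> 15 * K" by simp
    then show ?thesis using dist_axis_le[of "f + G t" "n (f + G s)"] D_sym by simp
  qed
  have "(+) h ` range G \<in> (\<lambda>e. (+) (- e) ` range G) ` F" for h
  proof (rule image_eqI)
    define a where "a = n (- h)"
    define e where "e = - G a + - h"
    show "e \<in> F" using MF(3)[OF near near, of "- h" 0] by (simp add: e_def a_def G_zero del: add_uminus_conv_diff)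
    have eq: "- e = h + G a" by (simp add: e_def minus_add del: add_uminus_conv_diff)
    show "(+) h ` range G = (+) (- e) ` range G"
    proof (intro equalityI subsetI)
      fix y assume "y \<in> (+) h ` range G"
      then obtain i where "y = h + G i" by blast
      then have "y = - e + G (i - a)" unfolding eq by (simp add: add.assoc G_add[symmetric])
      then show "y \<in> (+) (- e) ` range G" by blast
    next
      fix y assume "y \<in> (+) (- e) ` range G"
      then obtain i where "y = - e + G i" by blast
      then have "y = h + G (a + i)" unfolding eq by (simp add: add.assoc G_add)
      then show "y \<in> (+) h ` range G" by blast
    qed
  qed
  then have "range (\<lambda>h. (+) h ` range G) \<subseteq> (\<lambda>e. (+) (- e) ` range G) ` F" by blast
  then show ?thesis using MF(2) finite_surj by blast
qed

end

section \<open>Ping-pong with a transverse translate\<close>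

locale transverse_translate = quasi_axis +
  fixes \<gamma> :: "'a" and C :: real
  assumes parallel_or_bounded: "parallel h \<or> (\<forall>i j. gap (h + G i) (h + G j) \<le> C)"
    and not_parallel: "\<not> parallel \<gamma>"
begin

lemma C_nonneg: "C \<ge> 0"
  using parallel_or_bounded[of \<gamma>] not_parallel by force

text \<open>
  Large enough to absorb the error of \<open>behrstock\<close>, and to let \<open>W\<close> contain the projections to the
  axis of its transverse translates by \<open>\<gamma>\<close> and \<open>- \<gamma>\<close>.
\<close>

definition \<delta> :: real where
  "\<delta> = C + 7 * K + \<bar>real_of_int (n \<gamma>)\<bar> + \<bar>real_of_int (n (- \<gamma>))\<bar>"

definition W :: "'a set" where "W = {x. \<bar>real_of_int (n x)\<bar> \<le> \<delta>}"

lemma delta_gt_K: "\<delta> > K"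
  using C_nonneg K_pos unfolding \<delta>_def by linarith

lemma not_parallel_bounded:
  assumes "\<not> parallel h"
  shows "gap (h + G i) (h + G j) \<le> C" "gap (- h + G i) (- h + G j) \<le> C"
  using assms parallel_or_bounded[of h] parallel_or_bounded[of "- h"] parallel_minus[of "- h"]
  by auto

lemma translate_axis_in_W:
  assumes "s = \<gamma> \<or> s = - \<gamma>"
  shows "\<bar>real_of_int (n (s + G i))\<bar> \<le> \<delta>"
  using assms not_parallel_bounded[OF not_parallel, of i 0] K_pos
  unfolding \<delta>_def by (auto simp: G_zero)

text \<open>
  This makes ping-pong possible: by \<open>behrstock\<close>, an element cannot project far from the junction on
  both of two transverse axes.
\<close>

lemma W_cover:
  assumes "s = \<gamma> \<or> s = - \<gamma>"
  shows "\<bar>real_of_int (n x)\<bar> \<le> \<delta> \<or> \<bar>real_of_int (n (- s + x))\<bar> \<le> \<delta>"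
proof -
  have "gap x s \<le> C + 7 * K \<or> gap (- s + x) (- s) \<le> C + 7 * K"
    using assms not_parallel_bounded[OF not_parallel] by (intro behrstock) auto
  then show ?thesis using assms unfolding \<delta>_def by auto
qed

lemma n_diff: "n (- (h + G i) + x) = n (- h + x) - i"
  using n_G_add[of "- i" "- h + x"]
  by (simp add: minus_add G_minus add.assoc del: add_uminus_conv_diff)

text \<open>
  If the segment on the translate by \<open>h\<close> separates \<open>x, u\<close> from \<open>y, z\<close>, then its midpoint \<open>a\<close> is
  coarsely between \<open>x\<close> and \<open>z\<close>, and also between \<open>u\<close> and \<open>y\<close>.  If the segment on the translate
  by \<open>k\<close> separates \<open>x, z\<close> from \<open>y, u\<close>, this forces \<open>a\<close> to project near both of its ends.
\<close>

lemma noncrossing_intervals: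
  assumes r: "\<bar>real_of_int r\<bar> > 4 * \<delta> + 8 * K + 2"
    and h: "\<bar>real_of_int (n (- h + x))\<bar> \<le> \<delta>" "\<bar>real_of_int (n (- h + u))\<bar> \<le> \<delta>"
      "\<bar>real_of_int (n (- h + y) - r)\<bar> \<le> \<delta>" "\<bar>real_of_int (n (- h + z) - r)\<bar> \<le> \<delta>"
    and k: "\<bar>real_of_int (n (- k + x))\<bar> \<le> \<delta>" "\<bar>real_of_int (n (- k + z))\<bar> \<le> \<delta>"
      "\<bar>real_of_int (n (- k + y) - r)\<bar> \<le> \<delta>" "\<bar>real_of_int (n (- k + u) - r)\<bar> \<le> \<delta>"
  shows False
proof -
  define i where "i = r div 2"
  have "2 * i \<le> r" "r \<le> 2 * i + 1" unfolding i_def by linarith+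
  then have i: "2 * real_of_int i \<le> real_of_int r" "real_of_int r \<le> 2 * real_of_int i + 1"
    by linarith+
  define a where "a = h + G i"
  have between: "D b a + D a c \<le> D b c + 3 * K"
    if "\<bar>real_of_int (n (- h + b))\<bar> \<le> \<delta>" "\<bar>real_of_int (n (- h + c) - r)\<bar> \<le> \<delta>" for b c
  proof -
    have c: "\<bar>real_of_int (n (- h + c)) - real_of_int r\<bar> \<le> \<delta>" using that(2) by simp
    have "D (- h + b) (G i) + D (G i) (- h + c) \<le> D (- h + b) (- h + c) + 3 * K"
    proof (rule passes_between)
      show "gap (- h + b) (- h + c) > K"
        using that(1) c r i K_pos delta_gt_K by linarith
      show "\<bar>real_of_int (n (- h + b)) - real_of_int i\<bar> +
          \<bar>real_of_int i - real_of_int (n (- h + c))\<bar> = gap (- h + b) (- h + c)"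
      proof (cases "r \<ge> 0")
        case True
        then have "real_of_int r \<ge> 0" by simp
        then show ?thesis using that(1) c r i K_pos delta_gt_K by linarith
      next
        case False
        then have "real_of_int r \<le> 0" by simp
        then show ?thesis using that(1) c r i K_pos delta_gt_K by linarith
      qed
    qed
    then show ?thesis unfolding a_def by (simp add: D_shift add.assoc[symmetric])
  qed
  have inside: "gap (- k + b) (- k + a) + gap (- k + a) (- k + c) \<le> gap (- k + b) (- k + c) + 6 * K"
    if "D b a + D a c \<le> D b c + 3 * K" for b c
  proof -
    have "D (- k + b) (- k + a) + D (- k + a) (- k + c) \<le> D (- k + b) (- k + c) + 3 * K"
      using that by (simp add: D_translate)
    from projection_between[OF this] show ?thesis using K_pos by simp
  qed
  have pinned: "\<bar>real_of_int (n (- k + a)) - m\<bar> \<le> 2 * \<delta> + 3 * K"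
    if "gap (- k + b) (- k + a) + gap (- k + a) (- k + c) \<le> gap (- k + b) (- k + c) + 6 * K"
      "\<bar>real_of_int (n (- k + b)) - m\<bar> \<le> \<delta>" "\<bar>real_of_int (n (- k + c)) - m\<bar> \<le> \<delta>" for b c m
    using that delta_gt_K K_pos by linarith
  have "\<bar>real_of_int (n (- k + a)) - 0\<bar> \<le> 2 * \<delta> + 3 * K"
    using h k by (intro pinned[of x z] inside between) auto
  moreover have "\<bar>real_of_int (n (- k + a)) - real_of_int r\<bar> \<le> 2 * \<delta> + 3 * K"
    using h k by (intro pinned[of u y] inside between) auto
  ultimately show False using r K_pos by linarith
qed

end

section \<open>Paths alternating between axis segments and turns\<close>

text \<open>
  The path follows a segment of length \<open>p k\<close> on the translate of the axis by \<open>hs k\<close> and then turns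
  into the next translate by \<open>\<gamma>\<close> or \<open>- \<gamma>\<close>.
\<close>

locale axis_path = transverse_translate +
  fixes p :: "nat \<Rightarrow> int" and s :: "nat \<Rightarrow> 'a" and hs :: "nat \<Rightarrow> 'a"
  assumes step: "s k = \<gamma> \<or> s k = - \<gamma>"
    and hs_Suc: "hs (Suc k) = hs k + G (p k) + s k"
    and long: "\<bar>real_of_int (p k)\<bar> > 4 * \<delta> + 14 * K"
begin

abbreviation at_start :: "nat \<Rightarrow> 'a \<Rightarrow> bool" where
  "at_start k x \<equiv> \<bar>real_of_int (n (- hs k + x))\<bar> \<le> \<delta>"

abbreviation at_end :: "nat \<Rightarrow> 'a \<Rightarrow> bool" where
  "at_end k x \<equiv> \<bar>real_of_int (n (- hs k + x) - p k)\<bar> \<le> \<delta>"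

lemma start_end_disjoint: "at_start k x \<Longrightarrow> at_end k x \<Longrightarrow> False"
  using long[of k] delta_gt_K K_pos by simp

lemma step_shift: "- hs (Suc k) + x = - s k + (- (hs k + G (p k)) + x)"
  unfolding hs_Suc by (simp add: minus_add add.assoc del: add_uminus_conv_diff)

lemma adjacent_cover: "at_end k x \<or> at_start (Suc k) x"
  using W_cover[OF step, of "- (hs k + G (p k)) + x" k] unfolding n_diff step_shift .

text \<open>
  Consecutive pieces satisfy the covering condition, and since the start and the end side of a
  piece are disjoint, the condition propagates to all pairs.  No local-to-global argument in the
  space is needed.
\<close>

lemma ordered: "j < k \<Longrightarrow> at_end j x \<or> at_start k x"
proof (induction k)
  case (Suc k)
  then show ?case
    using adjacent_cover[of j x] adjacent_cover[of k x] start_end_disjoint[of k x] by (cases "j = k") auto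
qed simp

lemma at_start_mono: "at_start j x \<Longrightarrow> j \<le> k \<Longrightarrow> at_start k x"
  using ordered[of j k x] start_end_disjoint[of j x] by (cases "j = k") auto

lemma at_end_antimono: "at_end k x \<Longrightarrow> j \<le> k \<Longrightarrow> at_end j x"
  using ordered[of j k x] start_end_disjoint[of k x] by (cases "j = k") auto

lemma earlier_at_start:
  assumes "j < k"
  shows "at_start k (hs j + G i)"
proof (rule at_start_mono)
  have "- (hs j + G (p j)) + (hs j + G i) = G (i - p j)"
    using G_add[of "- p j" i]
    by (simp add: minus_add G_minus add.assoc del: add_uminus_conv_diff)
  moreover have "- s j = \<gamma> \<or> - s j = - \<gamma>" using step[of j] by auto
  ultimately show "at_start (Suc j) (hs j + G i)"
    unfolding step_shift by (simp add: translate_axis_in_W)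
qed (use assms in simp)

lemma later_at_end:
  assumes "j < k"
  shows "at_end j (hs k + G i)"
proof -
  obtain l where l: "k = Suc l" "j \<le> l" using assms by (cases k) auto
  have "- hs l + (hs k + G i) = G (p l) + (s l + G i)"
    unfolding l hs_Suc by (simp add: add.assoc)
  then have "at_end l (hs k + G i)"
    using translate_axis_in_W[OF step[of l], of i] by (simp add: n_G_add)
  then show ?thesis using at_end_antimono l(2) by blast
qed

lemma hs_at_start: "at_start k (hs 0)"
proof (rule at_start_mono)
  show "at_start 0 (hs 0)" using n_zero_le delta_gt_K by simp
qed simp

lemma hs_at_end: "k < m \<Longrightarrow> at_end k (hs m)"
  using later_at_end[of k m 0] by (simp add: G_zero)

text \<open>
  If no piece of the path lies on a translate parallel to that by \<open>h\<close>, then by \<open>behrstock\<close> each piece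
  projects to the translate by \<open>h\<close> near the projection of the start or near the projection of the
  end of the path, because the ends of the path have distant projections to the piece.  Consecutive
  pieces project close together, so somewhere the projections of start and end are close, contrary
  to the assumption.
  
  If a piece lies on a parallel translate, the projections to the two translates agree, and the ends
  of the path project to that piece near its own ends.
\<close>

lemma crossing_matches_piece:
  assumes "gap (- h + hs 0) (- h + hs m) > 3 * C + 15 * K + nu \<gamma>"
  shows "\<exists>k<m. D (h + G (n (- h + hs 0))) (hs k) \<le> \<delta> + 16 * K \<and>
    D (h + G (n (- h + hs m))) (hs k + G (p k)) \<le> \<delta> + 16 * K \<and>
    gap (- h + hs 0) (- h + hs m) \<le> \<bar>real_of_int (p k)\<bar> + 2 * \<delta> + 34 * K"
proof -
  have nug: "nu \<gamma> \<ge> 0" using D_nonneg[of 0 \<gamma>] by (simp add: D_zero)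
  have "\<exists>k<m. parallel (- h + hs k)"
  proof (rule ccontr)
    assume "\<not> ?thesis"
    then have npar: "\<not> parallel (- h + hs k)" if "k < m" for k using that by blast
    define a where "a k = n (- h + hs k)" for k
    have close: "\<bar>real_of_int (a 0) - real_of_int (a k)\<bar> \<le> C + 7 * K \<or>
        \<bar>real_of_int (a m) - real_of_int (a k)\<bar> \<le> C + 7 * K" if k: "k < m" for k
    proof -
      define f where "f = - h + hs k"
      have f: "- f = - hs k + h" "- f + (- h + x) = - hs k + x" for x
        unfolding f_def by (simp_all add: minus_add add.assoc del: add_uminus_conv_diff)
      have "gap (- h + x) f \<le> C + 7 * K \<or> gap (- f + (- h + x)) (- f) \<le> C + 7 * K" for x
        using npar[OF k] by (intro behrstock not_parallel_bounded) (auto simp: f_def)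
      then have "gap (- h + x) f \<le> C + 7 * K \<or> gap (- hs k + x) (- f) \<le> C + 7 * K" for x
        unfolding f(2) .
      note start = this[of "hs 0"] and finish = this[of "hs m"]
      have "\<not> (gap (- hs k + hs 0) (- f) \<le> C + 7 * K \<and> gap (- hs k + hs m) (- f) \<le> C + 7 * K)"
      proof
        assume "gap (- hs k + hs 0) (- f) \<le> C + 7 * K \<and> gap (- hs k + hs m) (- f) \<le> C + 7 * K"
        moreover have "C + 7 * K \<le> \<delta>" unfolding \<delta>_def by simp
        ultimately have "gap (- hs k + hs 0) (- f) \<le> \<delta>" "gap (- hs k + hs m) (- f) \<le> \<delta>"
          by linarith+
        then show False
          using hs_at_start[of k] hs_at_end[OF k] long[of k] K_pos unfolding of_int_diff by linarith
      qed
      then show ?thesis using start finish unfolding a_def f_def by blast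
    qed
    have jump: "\<bar>real_of_int (a (Suc k)) - real_of_int (a k)\<bar> \<le> C + nu \<gamma> + K" if k: "k < m" for k
    proof -
      define f where "f = - h + hs k"
      have "D (f + G (p k)) (- h + hs (Suc k)) = nu (s k)"
        unfolding f_def hs_Suc by (simp add: D_add_right flip: add.assoc)
      also have "\<dots> = nu \<gamma>" using step[of k] nu_minus[of \<gamma>] by auto
      finally have "gap (f + G (p k)) (- h + hs (Suc k)) \<le> nu \<gamma> + K"
        using gap_le_D[of "f + G (p k)" "- h + hs (Suc k)"] by simp
      moreover have "gap (f + G (p k)) f \<le> C"
        using not_parallel_bounded(1)[OF npar[OF k], of "p k" 0] by (simp add: f_def G_zero)
      ultimately show ?thesis unfolding a_def f_def by linarith
    qed
    have big: "\<bar>real_of_int (a 0) - real_of_int (a m)\<bar> > 3 * C + 15 * K + nu \<gamma>"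
      using assms unfolding a_def .
    have near: "k < m \<Longrightarrow> \<bar>real_of_int (a 0) - real_of_int (a k)\<bar> \<le> C + 7 * K" for k
    proof (induction k)
      case 0 then show ?case using C_nonneg K_pos by simp
    next
      case (Suc k)
      then have "\<bar>real_of_int (a 0) - real_of_int (a k)\<bar> \<le> C + 7 * K" by simp
      then have "\<not> \<bar>real_of_int (a m) - real_of_int (a (Suc k))\<bar> \<le> C + 7 * K"
        using jump[of k] Suc.prems big by linarith
      then show ?case using close[OF Suc.prems] by blast
    qed
    show False
    proof (cases m)
      case 0 then show False using big C_nonneg K_pos nug by simp
    next
      case (Suc l)
      then have "l < m" by simp
      then show False using jump[of l] near[of l] big C_nonneg K_pos nug unfolding Suc by simp
    qed
  qed
  then obtain k where k: "k < m" "parallel (- h + hs k)" by blast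
  have close: "D (h + G (n (- h + x))) (hs k + G (n (- hs k + x))) \<le> 15 * K" for x
  proof -
    have "D (G (n (- h + x))) (- h + hs k + G (n (- (- h + hs k) + (- h + x)))) \<le> 15 * K"
      using k(2) unfolding parallel_def by blast
    moreover have "- (- h + hs k) + (- h + x) = - hs k + x"
      by (simp add: minus_add add.assoc del: add_uminus_conv_diff)
    ultimately show ?thesis by (simp add: D_shift add.assoc)
  qed
  have "D (hs k + G i) (hs k + G j) \<le> \<bar>real_of_int i - real_of_int j\<bar> + K" for i j
    unfolding D_translate using D_G[of i j] by linarith
  from this[of "n (- hs k + hs 0)" 0] this[of "n (- hs k + hs m)" "p k"]
  have "D (hs k + G (n (- hs k + hs 0))) (hs k) \<le> \<delta> + K"
    "D (hs k + G (n (- hs k + hs m))) (hs k + G (p k)) \<le> \<delta> + K"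
    using hs_at_start[of k] hs_at_end[OF k(1)] by (simp_all add: G_zero)
  then have ends: "D (h + G (n (- h + hs 0))) (hs k) \<le> \<delta> + 16 * K"
    "D (h + G (n (- h + hs m))) (hs k + G (p k)) \<le> \<delta> + 16 * K"
    using close[of "hs 0"] close[of "hs m"]
      D_triangle[of "h + G (n (- h + hs 0))" "hs k" "hs k + G (n (- hs k + hs 0))"]
      D_triangle[of "h + G (n (- h + hs m))" "hs k + G (p k)" "hs k + G (n (- hs k + hs m))"]
    by linarith+
  have "gap (- h + hs 0) (- h + hs m) \<le> D (h + G (n (- h + hs 0))) (h + G (n (- h + hs m))) + K"
    unfolding D_translate using D_G[of "n (- h + hs 0)" "n (- h + hs m)"] by linarith
  also have "\<dots> \<le> \<bar>real_of_int (p k)\<bar> + 2 * \<delta> + 34 * K"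
    using ends D_triangle[of "h + G (n (- h + hs 0))" "h + G (n (- h + hs m))" "hs k"]
      D_triangle[of "hs k" "h + G (n (- h + hs m))" "hs k + G (p k)"]
      D_sym[of "hs k + G (p k)" "h + G (n (- h + hs m))"]
      D_add_right[of "hs k" "G (p k)"] nu_G[of "p k"]
    by linarith
  finally show ?thesis using k(1) ends by blast
qed

text \<open>
  For any other \<open>l\<close> some piece separates \<open>hs l\<close> from the end of the piece \<open>k\<close> by its length: the
  piece \<open>l\<close> if \<open>l \<le> k\<close>, and the piece \<open>Suc k\<close> if \<open>l > Suc k\<close>.
\<close>

lemma close_ends_adjacent:
  assumes "D (hs l) (hs k + G (p k)) \<le> c" "\<And>j. \<bar>real_of_int (p j)\<bar> > c + 2 * \<delta> + K"
  shows "l = Suc k"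
proof (rule ccontr)
  assume "l \<noteq> Suc k"
  define e where "e = hs k + G (p k)"
  have "\<exists>j. at_start j e \<and> at_end j (hs l) \<or> at_start j (hs l) \<and> at_end j e"
  proof (cases "l \<le> k")
    case True
    have "at_start l (hs l)" using n_zero_le delta_gt_K by simp
    moreover have "at_end l e"
    proof (cases "l = k")
      case True
      then have "n (- hs l + e) - p l = n 0"
        by (simp add: e_def n_G add.assoc[symmetric])
      then show ?thesis using n_zero_le delta_gt_K by simp
    next
      case False
      then show ?thesis using later_at_end \<open>l \<le> k\<close> by (simp add: e_def)
    qed
    ultimately show ?thesis by blast
  next
    case False
    then have "at_end (Suc k) (hs l)" using \<open>l \<noteq> Suc k\<close> by (intro hs_at_end) simp
    moreover have "at_start (Suc k) e" unfolding e_def by (intro earlier_at_start) simp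
    ultimately show ?thesis by blast
  qed
  then obtain j where "at_start j e \<and> at_end j (hs l) \<or> at_start j (hs l) \<and> at_end j e" by blast
  moreover have "gap (- hs j + hs l) (- hs j + e) \<le> c + K"
    using gap_le_D[of "- hs j + hs l" "- hs j + e"] assms(1) unfolding e_def D_translate by linarith
  ultimately show False using assms(2)[of j] unfolding of_int_diff by linarith
qed

end

section \<open>Counting a word with pieces of different lengths\<close>

context transverse_translate begin

text \<open>
  The pair of sides belonging to the word is \<open>W\<close> and \<open>V r q\<close>: the start side of the first piece and
  the end side of the last.
\<close>

definition word :: "int \<Rightarrow> int \<Rightarrow> 'a" where
  "word r q = G r + \<gamma> + G q"

definition V :: "int \<Rightarrow> int \<Rightarrow> 'a set" where
  "V r q = {z. - word r q + z \<in> W}"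

lemma V_iff: "- h + z \<in> V r q \<longleftrightarrow> \<bar>real_of_int (n (- (h + G r + \<gamma>) + z) - q)\<bar> \<le> \<delta>"
proof -
  have "- word r q + (- h + z) = - ((h + G r + \<gamma>) + G q) + z"
    unfolding word_def by (simp add: minus_add add.assoc del: add_uminus_conv_diff)
  then show ?thesis unfolding V_def W_def mem_Collect_eq using n_diff by simp
qed

lemma W_iff: "- h + z \<in> W \<longleftrightarrow> \<bar>real_of_int (n (- h + z))\<bar> \<le> \<delta>"
  by (simp add: W_def)

lemma piece_cover:
  "\<bar>real_of_int (n (- h + z) - r)\<bar> \<le> \<delta> \<or> \<bar>real_of_int (n (- (h + G r + \<gamma>) + z))\<bar> \<le> \<delta>"
proof -
  have "- (h + G r + \<gamma>) + z = - \<gamma> + (- (h + G r) + z)"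
    by (simp add: minus_add add.assoc del: add_uminus_conv_diff)
  then show ?thesis
    using W_cover[of \<gamma> "- (h + G r) + z"] unfolding n_diff by auto
qed

lemma V_first_piece:
  assumes "\<bar>real_of_int q\<bar> > 2 * \<delta>" "- h + z \<in> V r q"
  shows "\<bar>real_of_int (n (- h + z) - r)\<bar> \<le> \<delta>"
  using assms piece_cover[of h z r] unfolding V_iff of_int_diff by linarith

lemma W_second_piece:
  assumes "\<bar>real_of_int r\<bar> > 2 * \<delta>" "- h + z \<in> W"
  shows "\<bar>real_of_int (n (- (h + G r + \<gamma>) + z))\<bar> \<le> \<delta>"
  using assms piece_cover[of h z r] unfolding W_iff of_int_diff by linarith

text \<open>
  Each link has the midpoint \<open>a\<close> of its first piece strictly between \<open>x\<close> and \<open>y\<close>, and the other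
  links form a chain from \<open>a\<close> to \<open>y\<close>.  The progress from \<open>x\<close> to \<open>a\<close> outweighs the accumulated
  error of \<open>3 * K\<close>.
\<close>

lemma chain_length_le:
  assumes r: "\<bar>real_of_int r\<bar> > 4 * \<delta> + 20 * K + 4" and q: "\<bar>real_of_int q\<bar> > 2 * \<delta>"
  shows "chain W (V r q) {x} {y} hs \<Longrightarrow> real (length hs) \<le> D x y"
proof (induction hs arbitrary: x)
  case Nil then show ?case by (simp add: D_nonneg)
next
  case (Cons h hs)
  have x: "\<bar>real_of_int (n (- h + x))\<bar> \<le> \<delta>"
    using Cons.prems by (simp add: chain_def W_iff)
  have y: "\<bar>real_of_int (n (- h + y)) - real_of_int r\<bar> \<le> \<delta>"
    using Cons.prems V_first_piece[OF q, of h y r] by (simp add: chain_def)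
  define i where "i = r div 2"
  have "2 * i \<le> r" "r \<le> 2 * i + 1" unfolding i_def by linarith+
  then have i: "2 * real_of_int i \<le> real_of_int r" "real_of_int r \<le> 2 * real_of_int i + 1"
    by linarith+
  define a where "a = h + G i"
  have na: "\<bar>real_of_int (n (- h + a)) - real_of_int i\<bar> \<le> K"
    unfolding a_def using n_zero_le by (simp add: n_G add.assoc[symmetric])
  have "D (- h + x) (G i) + D (G i) (- h + y) \<le> D (- h + x) (- h + y) + 3 * K"
  proof (rule passes_between)
    show "gap (- h + x) (- h + y) > K" using x y r K_pos delta_gt_K by linarith
    show "\<bar>real_of_int (n (- h + x)) - real_of_int i\<bar> +
        \<bar>real_of_int i - real_of_int (n (- h + y))\<bar> = gap (- h + x) (- h + y)"
    proof (cases "r \<ge> 0")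
      case True
      then have "real_of_int r \<ge> 0" by simp
      then show ?thesis using x y r i K_pos delta_gt_K by linarith
    next
      case False
      then have "real_of_int r \<le> 0" by simp
      then show ?thesis using x y r i K_pos delta_gt_K by linarith
    qed
  qed
  then have between: "D x a + D a y \<le> D x y + 3 * K"
    unfolding a_def by (simp add: D_shift add.assoc[symmetric])
  have "gap (- h + x) (- h + a) \<le> D x a + K"
    using gap_le_D[of "- h + x" "- h + a"] unfolding D_translate .
  then have "D x a \<ge> 3 * K + 1"
    using x na i r delta_gt_K K_pos by linarith
  moreover have "chain W (V r q) {a} {y} hs"
  proof -
    have "\<not> \<bar>real_of_int (n (- h + a) - r)\<bar> \<le> \<delta>"
      using na i r delta_gt_K K_pos unfolding of_int_diff by linarith
    then have "- h + a \<notin> V r q" using V_first_piece[OF q] by blast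
    then show ?thesis using Cons.prems unfolding chain_def precedes_def by auto
  qed
  then have "real (length hs) \<le> D a y" by (rule Cons.IH)
  ultimately show ?case using between by simp
qed

lemma separating_pair_word:
  assumes r: "\<bar>real_of_int r\<bar> > 4 * \<delta> + 20 * K + 4" and q: "\<bar>real_of_int q\<bar> > 2 * \<delta>"
  shows "separating_pair W (V r q)"
proof
  fix h k x u y z
  assume "- h + x \<in> W" "- h + u \<in> W" "- h + y \<in> V r q" "- h + z \<in> V r q"
    "- k + x \<in> W" "- k + u \<in> V r q" "- k + y \<in> V r q" "- k + z \<in> W"
  then show False
    using r K_pos V_first_piece[OF q, of _ _ r]
    by (intro noncrossing_intervals[of r h x u y z k]) (auto simp: W_iff)
next
  fix x y
  have "length hs \<le> nat \<lceil>D x y\<rceil>" if "chain W (V r q) {x} {y} hs" for hs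
    using chain_length_le[OF r q that] by linarith
  then show "\<exists>m. \<forall>hs. chain W (V r q) {x} {y} hs \<longrightarrow> length hs \<le> m" by blast
qed

text \<open>
  The absolute values \<open>1, 1, 2, 4\<close> make the longest piece unique and distinguish its two neighbours
  in the periodic word; the signs make the exponents of a period add up to zero.
\<close>

definition exponent :: "int \<Rightarrow> nat \<Rightarrow> int" where
  "exponent \<kappa> j = (if j mod 4 = 2 then 2 * \<kappa> else if j mod 4 = 3 then - 4 * \<kappa> else \<kappa>)"

definition turn :: "nat \<Rightarrow> 'a" where
  "turn j = (if even j then \<gamma> else - \<gamma>)"

primrec waypoint :: "int \<Rightarrow> nat \<Rightarrow> 'a" where
  "waypoint \<kappa> 0 = 0"
| "waypoint \<kappa> (Suc j) = waypoint \<kappa> j + G (exponent \<kappa> j) + turn j"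

abbreviation target :: "int \<Rightarrow> 'a set" where
  "target \<kappa> \<equiv> V (2 * \<kappa>) (- 4 * \<kappa>)"

abbreviation phi :: "int \<Rightarrow> 'a \<Rightarrow> real" where
  "phi \<kappa> \<equiv> separating_pair.count_hom W (target \<kappa>)"

text \<open>
  Exceeds every error that occurs when the pieces of two paths are compared.
\<close>

definition threshold :: real where
  "threshold = 8 * \<delta> + 80 * K + 3 * C + 2 * nu \<gamma> + 4"

lemma threshold_bounds:
  "threshold > 4 * \<delta> + 34 * K" "threshold > 4 * \<delta> + 20 * K + 4"
  "threshold > (4 * \<delta> + 34 * K + nu \<gamma>) + 2 * \<delta> + K"
  "threshold > 2 * \<delta> + 3 * C + 15 * K + nu \<gamma>"
  using delta_gt_K K_pos C_nonneg D_nonneg[of 0 \<gamma>] unfolding threshold_def D_zero by linarith+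

lemma exponent_ge: "real_of_int \<kappa> > threshold \<Longrightarrow> \<bar>real_of_int (exponent \<kappa> j)\<bar> \<ge> \<kappa>"
  using threshold_bounds(1) delta_gt_K K_pos by (auto simp: exponent_def)

lemma axis_path_path:
  assumes "real_of_int \<kappa> > threshold"
  shows "axis_path nu G n K \<gamma> C (exponent \<kappa>) turn (waypoint \<kappa>)"
proof
  fix k show "4 * \<delta> + 14 * K < \<bar>real_of_int (exponent \<kappa> k)\<bar>"
    using exponent_ge[OF assms, of k] assms threshold_bounds(1) K_pos by linarith
qed (auto simp: turn_def)

lemma separating_pair_target:
  assumes "real_of_int \<kappa> > threshold"
  shows "separating_pair W (target \<kappa>)"
  using assms threshold_bounds K_pos delta_gt_K by (intro separating_pair_word) auto

lemma path_period: "waypoint \<kappa> (j + 4) = waypoint \<kappa> 4 + waypoint \<kappa> j"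
proof (induction j)
  case (Suc j)
  have "exponent \<kappa> (j + 4) = exponent \<kappa> j" "turn (j + 4) = turn j"
    by (auto simp: exponent_def turn_def)
  then show ?case unfolding add_Suc waypoint.simps Suc by (simp add: add.assoc)
qed simp

lemma real_hom_path:
  assumes "real_hom f"
  shows "f (waypoint \<kappa> (4 * m)) = 0"
proof -
  have add: "f (x + y) = f x + f y" for x y using assms unfolding real_hom_def by blast
  have zero: "f 0 = 0" using add[of 0 0] by simp
  have neg: "f (- x) = - f x" for x using add[of "- x" x] zero by simp
  have mult: "f (G (int k * \<kappa>)) = real k * f (G \<kappa>)" for k
    by (induction k) (simp_all add: zero G_zero distrib_right G_add add)
  have four: "f (G (4 * \<kappa>)) = 4 * f (G \<kappa>)" and two: "f (G (2 * \<kappa>)) = 2 * f (G \<kappa>)"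
    using mult[of 4] mult[of 2] by simp_all
  have "waypoint \<kappa> 4 = G \<kappa> + \<gamma> + G \<kappa> + - \<gamma> + G (2 * \<kappa>) + \<gamma> + G (- 4 * \<kappa>) + - \<gamma>"
  proof -
    have "exponent \<kappa> 0 = \<kappa>" "exponent \<kappa> 1 = \<kappa>" "exponent \<kappa> 2 = 2 * \<kappa>" "exponent \<kappa> 3 = - 4 * \<kappa>"
      "turn 0 = \<gamma>" "turn 1 = - \<gamma>" "turn 2 = \<gamma>" "turn 3 = - \<gamma>"
      by (simp_all add: exponent_def turn_def)
    moreover have "waypoint \<kappa> 1 = G (exponent \<kappa> 0) + turn 0" by simp
    moreover have "Suc 1 = 2" "Suc 2 = 3" "Suc 3 = 4" by simp_all
    ultimately show ?thesis
      using waypoint.simps(2)[of \<kappa> 1] waypoint.simps(2)[of \<kappa> 2] waypoint.simps(2)[of \<kappa> 3]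
      by (simp only:)
  qed
  then have "f (waypoint \<kappa> 4) = 0"
    using four two G_minus[of "4 * \<kappa>"] by (simp only: add neg mult_minus_left)
  then show ?thesis
    using path_period[of \<kappa> "4 * _"] by (induction m) (simp_all add: zero add add.commute[of 4])
qed

lemma count_path_ge:
  assumes "real_of_int \<kappa> > threshold"
  shows "m \<le> chain_count W (target \<kappa>) {0} {waypoint \<kappa> (4 * m)}"
proof -
  interpret axis_path nu G n K \<gamma> C "exponent \<kappa>" turn "waypoint \<kappa>" by (rule axis_path_path[OF assms])
  interpret separating_pair W "target \<kappa>" by (rule separating_pair_target[OF assms])
  have W: "- waypoint \<kappa> k + z \<in> W \<longleftrightarrow> at_start k z" for k z by (rule W_iff)
  have V: "- waypoint \<kappa> (4 * i + 2) + z \<in> target \<kappa> \<longleftrightarrow> at_end (4 * i + 3) z" for i z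
  proof -
    have mod: "(4 * i + 2) mod 4 = 2" "(4 * i + 3) mod 4 = 3" by presburger+
    have "exponent \<kappa> (4 * i + 2) = 2 * \<kappa>" "exponent \<kappa> (4 * i + 3) = - 4 * \<kappa>"
      unfolding exponent_def mod by simp_all
    moreover have "turn (4 * i + 2) = \<gamma>" "Suc (4 * i + 2) = 4 * i + 3"
      by (simp_all add: turn_def)
    moreover have "waypoint \<kappa> (Suc (4 * i + 2)) =
        waypoint \<kappa> (4 * i + 2) + G (exponent \<kappa> (4 * i + 2)) + turn (4 * i + 2)" by (rule waypoint.simps)
    ultimately have "waypoint \<kappa> (4 * i + 2) + G (2 * \<kappa>) + \<gamma> = waypoint \<kappa> (4 * i + 3)"
      "exponent \<kappa> (4 * i + 3) = - 4 * \<kappa>" by (simp_all only:)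
    then show ?thesis unfolding V_iff by simp
  qed
  \<comment> \<open>The counted word starts at the third piece of each period.\<close>
  have "chain W (target \<kappa>) {0} {waypoint \<kappa> (4 * m)} (map (\<lambda>i. waypoint \<kappa> (4 * i + 2)) [0..<m])"
    unfolding chain_def
  proof (intro conjI)
    show "sorted_wrt (precedes W (target \<kappa>)) (map (\<lambda>i. waypoint \<kappa> (4 * i + 2)) [0..<m])"
      unfolding sorted_wrt_iff_nth_less precedes_def length_map length_upt
    proof (intro allI impI)
      fix i j z assume "i < j" "j < m - 0"
      then have nth: "map (\<lambda>i. waypoint \<kappa> (4 * i + 2)) [0..<m] ! i = waypoint \<kappa> (4 * i + 2)"
        "map (\<lambda>i. waypoint \<kappa> (4 * i + 2)) [0..<m] ! j = waypoint \<kappa> (4 * j + 2)"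
        by (simp_all del: waypoint.simps)
      show "- (map (\<lambda>i. waypoint \<kappa> (4 * i + 2)) [0..<m] ! i) + z \<in> target \<kappa> \<or>
          - (map (\<lambda>i. waypoint \<kappa> (4 * i + 2)) [0..<m] ! j) + z \<in> W"
        unfolding nth W V by (rule ordered) (use \<open>i < j\<close> in simp)
    qed
    show "\<forall>h\<in>set (map (\<lambda>i. waypoint \<kappa> (4 * i + 2)) [0..<m]).
        (\<forall>x\<in>{0}. - h + x \<in> W) \<and> (\<forall>y\<in>{waypoint \<kappa> (4 * m)}. - h + y \<in> target \<kappa>)"
    proof
      fix h assume "h \<in> set (map (\<lambda>i. waypoint \<kappa> (4 * i + 2)) [0..<m])"
      then obtain i where i: "i < m" and h: "h = waypoint \<kappa> (4 * i + 2)"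
        by (auto simp del: waypoint.simps)
      have "at_start (4 * i + 2) (waypoint \<kappa> 0)" by (rule hs_at_start)
      moreover have "at_end (4 * i + 3) (waypoint \<kappa> (4 * m))" by (rule hs_at_end) (use i in simp)
      ultimately show "(\<forall>x\<in>{0}. - h + x \<in> W) \<and> (\<forall>y\<in>{waypoint \<kappa> (4 * m)}. - h + y \<in> target \<kappa>)"
        unfolding waypoint.simps(1) h W V[symmetric] by blast
    qed
  qed
  from length_le_count[OF _ _ this] show ?thesis by simp
qed

lemma piece_matched:
  assumes \<kappa>: "real_of_int \<kappa> > threshold" and r: "\<bar>real_of_int r\<bar> > threshold"
    and ends: "\<bar>real_of_int (n (- h + waypoint \<kappa> 0))\<bar> \<le> \<delta> \<and> \<bar>real_of_int (n (- h + waypoint \<kappa> m) - r)\<bar> \<le> \<delta> \<or>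
      \<bar>real_of_int (n (- h + waypoint \<kappa> m))\<bar> \<le> \<delta> \<and> \<bar>real_of_int (n (- h + waypoint \<kappa> 0) - r)\<bar> \<le> \<delta>"
  obtains k where "k < m" "D (h + G (n (- h + waypoint \<kappa> 0))) (waypoint \<kappa> k) \<le> \<delta> + 16 * K"
    "D (h + G (n (- h + waypoint \<kappa> m))) (waypoint \<kappa> k + G (exponent \<kappa> k)) \<le> \<delta> + 16 * K"
    "\<bar>real_of_int r\<bar> \<le> \<bar>real_of_int (exponent \<kappa> k)\<bar> + 4 * \<delta> + 34 * K"
proof -
  interpret axis_path nu G n K \<gamma> C "exponent \<kappa>" turn "waypoint \<kappa>" by (rule axis_path_path[OF \<kappa>])
  have gap: "gap (- h + waypoint \<kappa> 0) (- h + waypoint \<kappa> m) \<ge> \<bar>real_of_int r\<bar> - 2 * \<delta>"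
    using ends unfolding of_int_diff by linarith
  then have "gap (- h + waypoint \<kappa> 0) (- h + waypoint \<kappa> m) > 3 * C + 15 * K + nu \<gamma>"
    using r threshold_bounds(4) by linarith
  from crossing_matches_piece[OF this] obtain k where k: "k < m"
    "D (h + G (n (- h + waypoint \<kappa> 0))) (waypoint \<kappa> k) \<le> \<delta> + 16 * K"
    "D (h + G (n (- h + waypoint \<kappa> m))) (waypoint \<kappa> k + G (exponent \<kappa> k)) \<le> \<delta> + 16 * K"
    "gap (- h + waypoint \<kappa> 0) (- h + waypoint \<kappa> m) \<le> \<bar>real_of_int (exponent \<kappa> k)\<bar> + 2 * \<delta> + 34 * K"
    by blast
  from k(4) gap have "\<bar>real_of_int r\<bar> \<le> \<bar>real_of_int (exponent \<kappa> k)\<bar> + 4 * \<delta> + 34 * K"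
    by linarith
  with k(1-3) show thesis by (rule that)
qed

text \<open>
  In a reversed copy the piece of length \<open>4 \<kappa>\<close> can only be matched with a piece \<open>k\<close> of the same
  length.  The piece of length \<open>2 \<kappa>\<close> preceding it in the word is then matched with a piece starting
  where the piece \<open>k\<close> ends, hence with the next one, whose length is \<open>\<kappa>\<close>.
\<close>

lemma count_reversed_zero:
  assumes \<kappa>: "real_of_int \<kappa> > threshold"
  shows "chain_count W (target \<kappa>) {waypoint \<kappa> m} {0} = 0"
proof (rule ccontr)
  assume nz: "chain_count W (target \<kappa>) {waypoint \<kappa> m} {0} \<noteq> 0"
  interpret axis_path nu G n K \<gamma> C "exponent \<kappa>" turn "waypoint \<kappa>" by (rule axis_path_path[OF \<kappa>])
  interpret separating_pair W "target \<kappa>" by (rule separating_pair_target[OF \<kappa>])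
  note T = threshold_bounds
  obtain hs where hs: "chain W (target \<kappa>) {waypoint \<kappa> m} {0} hs" "hs \<noteq> []"
    using nz by (metis count_attained insert_not_empty list.size(3))
  define h where "h = hd hs"
  have h: "- h + waypoint \<kappa> m \<in> W" "- h + waypoint \<kappa> 0 \<in> target \<kappa>"
    using hs unfolding chain_def h_def by auto
  define h' where "h' = h + G (2 * \<kappa>) + \<gamma>"
  have big: "\<bar>real_of_int (2 * \<kappa>)\<bar> > threshold" "\<bar>real_of_int (- 4 * \<kappa>)\<bar> > threshold"
    using \<kappa> T(1) delta_gt_K K_pos by simp_all
  have big': "\<bar>real_of_int (2 * \<kappa>)\<bar> > 2 * \<delta>" "\<bar>real_of_int (- 4 * \<kappa>)\<bar> > 2 * \<delta>"
    using big T(1) delta_gt_K K_pos by simp_all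
  have c1: "\<bar>real_of_int (n (- h + waypoint \<kappa> m))\<bar> \<le> \<delta>"
    using h(1) unfolding W_iff .
  have c2: "\<bar>real_of_int (n (- h + waypoint \<kappa> 0) - 2 * \<kappa>)\<bar> \<le> \<delta>"
    using V_first_piece[OF big'(2) h(2)] .
  have c3: "\<bar>real_of_int (n (- h' + waypoint \<kappa> m))\<bar> \<le> \<delta>"
    using W_second_piece[OF big'(1) h(1)] unfolding h'_def .
  have c4: "\<bar>real_of_int (n (- h' + waypoint \<kappa> 0) - (- 4 * \<kappa>))\<bar> \<le> \<delta>"
    using h(2) unfolding V_iff h'_def .
  obtain l where l: "D (h + G (n (- h + waypoint \<kappa> 0))) (waypoint \<kappa> l) \<le> \<delta> + 16 * K"
    "\<bar>real_of_int (2 * \<kappa>)\<bar> \<le> \<bar>real_of_int (exponent \<kappa> l)\<bar> + 4 * \<delta> + 34 * K"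
    by (rule piece_matched[OF \<kappa> big(1), of h m]) (use c1 c2 in auto)
  obtain k where k: "D (h' + G (n (- h' + waypoint \<kappa> m))) (waypoint \<kappa> k + G (exponent \<kappa> k)) \<le> \<delta> + 16 * K"
    "\<bar>real_of_int (- 4 * \<kappa>)\<bar> \<le> \<bar>real_of_int (exponent \<kappa> k)\<bar> + 4 * \<delta> + 34 * K"
    by (rule piece_matched[OF \<kappa> big(2), of h' m]) (use c3 c4 in auto)
  have "k mod 4 = 3"
  proof (rule ccontr)
    assume "k mod 4 \<noteq> 3"
    then have "\<bar>real_of_int (exponent \<kappa> k)\<bar> \<le> 2 * real_of_int \<kappa>"
      using \<kappa> T(1) delta_gt_K K_pos by (auto simp: exponent_def)
    then show False using k(2) \<kappa> T(1) delta_gt_K K_pos by simp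
  qed
  have D_near: "D (h + G i) (h + G j) \<le> \<delta> + K" if "\<bar>real_of_int (i - j)\<bar> \<le> \<delta>" for h i j
    using that D_G[of i j] unfolding D_translate of_int_diff by linarith
  have "D (waypoint \<kappa> l) (waypoint \<kappa> k + G (exponent \<kappa> k)) \<le> 4 * \<delta> + 34 * K + nu \<gamma>"
  proof -
    have "D (h + G (2 * \<kappa>)) h' = nu \<gamma>" unfolding h'_def by (rule D_add_right)
    moreover have "D (h + G (n (- h + waypoint \<kappa> 0))) (h + G (2 * \<kappa>)) \<le> \<delta> + K"
      using c2 by (rule D_near)
    moreover have "D h' (h' + G (n (- h' + waypoint \<kappa> m))) \<le> \<delta> + K"
      using D_near[of 0 "n (- h' + waypoint \<kappa> m)" h'] c3 by (simp add: G_zero)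
    ultimately show ?thesis
      using l(1) k(1) D_sym[of "waypoint \<kappa> l" "h + G (n (- h + waypoint \<kappa> 0))"]
        D_triangle[of "waypoint \<kappa> l" "waypoint \<kappa> k + G (exponent \<kappa> k)" "h + G (n (- h + waypoint \<kappa> 0))"]
        D_triangle[of "h + G (n (- h + waypoint \<kappa> 0))" "waypoint \<kappa> k + G (exponent \<kappa> k)" "h + G (2 * \<kappa>)"]
        D_triangle[of "h + G (2 * \<kappa>)" "waypoint \<kappa> k + G (exponent \<kappa> k)" h']
        D_triangle[of h' "waypoint \<kappa> k + G (exponent \<kappa> k)" "h' + G (n (- h' + waypoint \<kappa> m))"]
      by linarith
  qed
  then have "l = Suc k"
  proof (rule close_ends_adjacent)
    fix j show "\<bar>real_of_int (exponent \<kappa> j)\<bar> > 4 * \<delta> + 34 * K + nu \<gamma> + 2 * \<delta> + K"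
      using exponent_ge[OF \<kappa>, of j] \<kappa> T(3) by linarith
  qed
  then have "l mod 4 = 0" using \<open>k mod 4 = 3\<close> by (simp add: mod_Suc)
  then have "exponent \<kappa> l = \<kappa>" by (simp add: exponent_def)
  then show False using l(2) \<kappa> T(1) delta_gt_K K_pos by simp
qed

text \<open>
  A copy in either direction would have to match its longest piece with a piece of the path.
\<close>

lemma count_shorter_zero:
  assumes \<kappa>: "real_of_int \<kappa> > threshold" and \<kappa>': "real_of_int \<kappa>' > \<kappa> + threshold"
    and xy: "x = 0 \<and> y = waypoint \<kappa> m \<or> x = waypoint \<kappa> m \<and> y = 0"
  shows "chain_count W (target \<kappa>') {x} {y} = 0"
proof (rule ccontr)
  assume nz: "chain_count W (target \<kappa>') {x} {y} \<noteq> 0"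
  note T = threshold_bounds
  have \<kappa>2: "real_of_int \<kappa>' > threshold" using \<kappa> \<kappa>' T(1) delta_gt_K K_pos by linarith
  interpret separating_pair W "target \<kappa>'" by (rule separating_pair_target[OF \<kappa>2])
  obtain hs where hs: "chain W (target \<kappa>') {x} {y} hs" "hs \<noteq> []"
    using nz by (metis count_attained insert_not_empty list.size(3))
  define h where "h = hd hs"
  have h: "- h + x \<in> W" "- h + y \<in> target \<kappa>'"
    using hs unfolding chain_def h_def by auto
  define h' where "h' = h + G (2 * \<kappa>') + \<gamma>"
  have big: "\<bar>real_of_int (- 4 * \<kappa>')\<bar> > threshold" "\<bar>real_of_int (2 * \<kappa>')\<bar> > 2 * \<delta>"
    using \<kappa>2 T(1) delta_gt_K K_pos by simp_all
  have "\<bar>real_of_int (n (- h' + x))\<bar> \<le> \<delta>"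
    using W_second_piece[OF big(2) h(1)] unfolding h'_def .
  moreover have "\<bar>real_of_int (n (- h' + y) - (- 4 * \<kappa>'))\<bar> \<le> \<delta>"
    using h(2) unfolding V_iff h'_def .
  ultimately have "\<bar>real_of_int (n (- h' + waypoint \<kappa> 0))\<bar> \<le> \<delta> \<and>
        \<bar>real_of_int (n (- h' + waypoint \<kappa> m) - (- 4 * \<kappa>'))\<bar> \<le> \<delta> \<or>
      \<bar>real_of_int (n (- h' + waypoint \<kappa> m))\<bar> \<le> \<delta> \<and>
        \<bar>real_of_int (n (- h' + waypoint \<kappa> 0) - (- 4 * \<kappa>'))\<bar> \<le> \<delta>"
    using xy unfolding waypoint.simps(1) by metis
  then obtain k where
    "\<bar>real_of_int (- 4 * \<kappa>')\<bar> \<le> \<bar>real_of_int (exponent \<kappa> k)\<bar> + 4 * \<delta> + 34 * K"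
    by (rule piece_matched[OF \<kappa> big(1)])
  moreover have "\<bar>real_of_int (exponent \<kappa> k)\<bar> \<le> 4 * real_of_int \<kappa>"
    using \<kappa> T(1) delta_gt_K K_pos by (auto simp: exponent_def)
  ultimately show False using \<kappa>' T(1) delta_gt_K K_pos by simp
qed

theorem exists_independent_quasi_homs:
  "\<exists>(\<Phi> :: nat \<Rightarrow> 'a \<Rightarrow> real) v. (\<forall>i. quasi_hom (\<Phi> i)) \<and> (\<forall>i m. \<Phi> i (v i m) \<ge> real m) \<and>
     (\<forall>i j m. j < i \<longrightarrow> \<Phi> i (v j m) = 0) \<and> (\<forall>f i m. real_hom f \<longrightarrow> f (v i m) = 0)"
proof -
  define T where "T = \<lceil>threshold\<rceil> + 1"
  have T: "real_of_int T > threshold" unfolding T_def by linarith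
  have T0: "real_of_int T > 0" using T threshold_bounds(1) delta_gt_K K_pos by linarith
  define \<kappa> where "\<kappa> i = (int i + 1) * T" for i
  have \<kappa>_real: "real_of_int (\<kappa> i) = real i * T + T" for i by (simp add: \<kappa>_def algebra_simps)
  have big: "real_of_int (\<kappa> i) > threshold" for i
    unfolding \<kappa>_real using T T0 by (smt (verit) mult_nonneg_nonneg of_nat_0_le_iff)
  have gap: "real_of_int (\<kappa> i) > real_of_int (\<kappa> j) + threshold" if "j < i" for i j
  proof -
    have "(real j + 1) * T \<le> real i * T" using that T0 by (intro mult_right_mono) auto
    then show ?thesis unfolding \<kappa>_real using T by (simp add: algebra_simps)
  qed
  have phi: "phi (\<kappa> i) h = real (chain_count W (target (\<kappa> i)) {0} {h}) -
      real (chain_count W (target (\<kappa> i)) {h} {0})" for i h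
    by (rule separating_pair.count_hom_def[OF separating_pair_target[OF big]])
  show ?thesis
  proof (intro exI conjI allI impI)
    fix i show "quasi_hom (phi (\<kappa> i))"
      by (rule separating_pair.quasi_hom_count_hom[OF separating_pair_target[OF big]])
  next
    fix i m show "phi (\<kappa> i) (waypoint (\<kappa> i) (4 * m)) \<ge> real m"
      unfolding phi using count_path_ge[OF big] count_reversed_zero[OF big] by simp
  next
    fix i j m :: nat assume "j < i"
    then show "phi (\<kappa> i) (waypoint (\<kappa> j) (4 * m)) = 0"
      unfolding phi using count_shorter_zero[OF big gap, of j i _ _ "4 * m"] by (simp del: waypoint.simps)
  next
    fix f :: "'a \<Rightarrow> real" and i m assume "real_hom f"
    then show "f (waypoint (\<kappa> i) (4 * m)) = 0" by (rule real_hom_path)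
  qed
qed

end

section \<open>Projections to contracting sets\<close>

lemma geodesic_path:
  fixes a b :: "'a::cat0_space"
  obtains c :: "real \<Rightarrow> 'a" where "c 0 = a" "c (dist a b) = b"
    "geodesic a b = c ` {0..dist a b}"
    "\<And>s t. 0 \<le> s \<Longrightarrow> s \<le> dist a b \<Longrightarrow> 0 \<le> t \<Longrightarrow> t \<le> dist a b \<Longrightarrow> dist (c s) (c t) = \<bar>s - t\<bar>"
  using geodesic_segment_geodesic[of a b] unfolding geodesic_segment_def by (auto 4 4)

lemma continuous_on_geodesic_path:
  assumes "\<And>s t. 0 \<le> s \<Longrightarrow> s \<le> L \<Longrightarrow> 0 \<le> t \<Longrightarrow> t \<le> L \<Longrightarrow> dist (c s) (c t) = \<bar>s - t :: real\<bar>"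
  shows "continuous_on {0..L} c"
  unfolding continuous_on_iff using assms by (auto simp: dist_real_def)

lemma compact_geodesic: "compact (geodesic a (b::'a::cat0_space))"
  by (rule geodesic_path[of a b]) (auto intro!: compact_continuous_image continuous_on_geodesic_path)

lemma geodesic_nonempty: "geodesic a (b::'a::cat0_space) \<noteq> {}"
  by (rule geodesic_path[of a b]) auto

lemma nearest_points_nonempty:
  assumes "compact S" "S \<noteq> {}"
  shows "nearest_points S x \<noteq> {}"
proof -
  have "continuous_on S (dist x)" by (intro continuous_intros)
  from continuous_attains_inf[OF assms this] show ?thesis
    unfolding nearest_points_def by blast
qed

lemma dist_nearest_point: "y \<in> nearest_points S x \<Longrightarrow> dist x y = infdist x S"
proof (rule antisym)
  assume y: "y \<in> nearest_points S x"
  show "infdist x S \<le> dist x y" using y by (intro infdist_le) (simp add: nearest_points_def)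
  show "dist x y \<le> infdist x S"
    using y unfolding nearest_points_def by (subst infdist_notempty) (auto intro!: cINF_greatest)
qed

lemma self_nearest: "x \<in> S \<Longrightarrow> x \<in> nearest_points S x"
  by (simp add: nearest_points_def)

locale contracting_set =
  fixes S :: "'a::cat0_space set" and B :: real
  assumes contracting: "contracting B S" and compact: "compact S" and nonempty: "S \<noteq> {}" and B_pos: "B > 0"
begin

lemma nearest_exists: obtains y where "y \<in> nearest_points S x"
  using nearest_points_nonempty[OF compact nonempty, of x] by blast

lemma ball_projection:
  assumes p: "p' \<in> nearest_points S p" and q: "q' \<in> nearest_points S q" and "dist p q < dist p p'"
  shows "dist p' q' < B"
proof -
  define U where "U = (\<Union>y\<in>ball p (dist p p'). nearest_points S y)"
  have "ball p (dist p p') \<inter> S = {}" using p by (force simp: nearest_points_def)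
  then have "diameter U < B" using contracting unfolding contracting_def U_def by blast
  moreover have "bounded U"
    using compact_imp_bounded[OF compact] by (rule bounded_subset) (auto simp: U_def nearest_points_def)
  moreover have "p \<in> ball p (dist p p')" "q \<in> ball p (dist p p')"
    using assms(3) zero_le_dist[of p q] by (auto simp del: zero_le_dist)
  then have "p' \<in> U" "q' \<in> U" using p q unfolding U_def by blast+
  ultimately show ?thesis using diameter_bounded_bound by fastforce
qed

lemma projection_step:
  assumes "\<And>s' t'. s \<le> s' \<Longrightarrow> s' \<le> t \<Longrightarrow> s \<le> t' \<Longrightarrow> t' \<le> t \<Longrightarrow> dist (c s') (c t') = \<bar>s' - t'\<bar>"
    and "\<And>u. s \<le> u \<Longrightarrow> u \<le> t \<Longrightarrow> infdist (c u) S > 2 * B"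
    and "a \<in> nearest_points S (c s)" "b \<in> nearest_points S (c t)"
    and "s \<le> t" "t - s \<le> real k * (2 * B)"
  shows "dist a b \<le> real (k + 1) * B"
  using assms
proof (induction k arbitrary: s a)
  case 0
  then have "s = t" by simp
  moreover have "dist (c s) a > 0" using 0(2)[of s] 0(3,5) B_pos by (simp add: dist_nearest_point)
  ultimately show ?case using ball_projection[OF 0(3,4)] by simp
next
  case (Suc k)
  have far: "dist (c s) a > 2 * B" using Suc(3)[of s] Suc(4,6) by (simp add: dist_nearest_point)
  show ?case
  proof (cases "t - s \<le> 2 * B")
    case True
    then have "dist (c s) (c t) < dist (c s) a" using far Suc(2)[of s t] Suc(6) by simp
    then have "dist a b < B" by (rule ball_projection[OF Suc(4,5)])
    moreover have "B \<le> real (Suc k + 1) * B" using B_pos by simp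
    ultimately show ?thesis by linarith
  next
    case False
    define u where "u = s + 2 * B"
    obtain e where e: "e \<in> nearest_points S (c u)" by (rule nearest_exists)
    have "dist e b \<le> real (k + 1) * B"
    proof (rule Suc.IH[of u e])
      show "t - u \<le> real k * (2 * B)" using Suc(7) by (simp add: u_def algebra_simps)
    qed (use Suc(2,3,5) e False B_pos in \<open>auto simp: u_def\<close>)
    moreover have "dist (c s) (c u) < dist (c s) a"
      using far Suc(2)[of s u] False B_pos by (simp add: u_def)
    then have "dist a e < B" by (rule ball_projection[OF Suc(4) e])
    ultimately show ?thesis using dist_triangle[of a b e] by (simp add: algebra_simps)
  qed
qed

text \<open>
  Let \<open>r\<close> and \<open>r'\<close> be the distances of the two ends from the set.  The parts of the path within
  the balls of these radii contribute less than \<open>B\<close> each to the projection.  The rest has length at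
  most \<open>dist a b\<close>, up to a constant, and as it stays at distance at least \<open>2 * B\<close>, its projection
  is at most half of that length, up to a constant.  So \<open>dist a b\<close> is bounded.
\<close>

lemma far_path_projection:
  assumes iso: "\<And>s t. 0 \<le> s \<Longrightarrow> s \<le> L \<Longrightarrow> 0 \<le> t \<Longrightarrow> t \<le> L \<Longrightarrow> dist (c s) (c t) = \<bar>s - t\<bar>"
    and far: "\<And>u. 0 \<le> u \<Longrightarrow> u \<le> L \<Longrightarrow> infdist (c u) S > 2 * B"
    and a: "a \<in> nearest_points S (c 0)" and b: "b \<in> nearest_points S (c L)" and L: "0 \<le> L"
  shows "dist a b \<le> 10 * B"
proof -
  define r where "r = dist (c 0) a"
  define r' where "r' = dist (c L) b"
  have r: "r > 2 * B" "r' > 2 * B"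
    using far[of 0] far[of L] a b L by (simp_all add: r_def r'_def dist_nearest_point)
  have L': "dist (c 0) (c L) = L" using iso[of 0 L] L by simp
  have LD: "L \<le> r + dist a b + r'"
    using L' dist_triangle[of "c 0" "c L" a] dist_triangle[of a "c L" b]
    by (simp add: r_def r'_def dist_commute)
  show ?thesis
  proof (cases "L < r + r'")
    case True
    \<comment> \<open>The two balls overlap; the path is at time \<open>t\<close> in both of them.\<close>
    define t where "t = L * r / (r + r')"
    have t: "0 \<le> t" "t \<le> L" "t < r" "L - t < r'"
    proof -
      have pos: "r > 0" "r' > 0" using r B_pos by linarith+
      have eq: "L - t = L * r' / (r + r')" using pos by (simp add: t_def field_simps)
      have "L / (r + r') < 1" using True pos by simp
      then have "L / (r + r') * r < 1 * r" "L / (r + r') * r' < 1 * r'"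
        using pos by (intro mult_strict_right_mono; simp)+
      then show "t < r" "L - t < r'" unfolding eq by (simp_all add: t_def)
      have "0 \<le> L - t" unfolding eq using pos L by simp
      then show "t \<le> L" by simp
      show "0 \<le> t" using pos L by (simp add: t_def)
    qed
    obtain e where e: "e \<in> nearest_points S (c t)" by (rule nearest_exists)
    have "dist a e < B" using t iso[of 0 t] L by (intro ball_projection[OF a e]) (simp add: r_def)
    moreover have "dist b e < B"
      using t iso[of L t] L by (intro ball_projection[OF b e]) (simp add: r'_def)
    ultimately show ?thesis using dist_triangle[of a b e] B_pos by (simp add: dist_commute)
  next
    case False
    define s where "s = r - B"
    define t where "t = L - r' + B"
    have st: "0 \<le> s" "s \<le> t" "t \<le> L" using False r B_pos by (auto simp: s_def t_def)
    obtain e where e: "e \<in> nearest_points S (c s)" by (rule nearest_exists)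
    obtain f where f: "f \<in> nearest_points S (c t)" by (rule nearest_exists)
    have ae: "dist a e < B"
      using st iso[of 0 s] L B_pos by (intro ball_projection[OF a e]) (simp add: r_def s_def)
    have bf: "dist b f < B"
      using st iso[of L t] L B_pos r by (intro ball_projection[OF b f]) (simp add: r'_def t_def)
    \<comment> \<open>Between the balls every step of length \<open>2 * B\<close> moves the projection by less than \<open>B\<close>.\<close>
    define k where "k = nat \<lceil>(t - s) / (2 * B)\<rceil>"
    have "(t - s) / (2 * B) \<ge> 0" using st B_pos by simp
    then have k: "(t - s) / (2 * B) \<le> real k" "real k \<le> (t - s) / (2 * B) + 1"
      unfolding k_def by linarith+
    have "dist e f \<le> real (k + 1) * B"
    proof (rule projection_step[of s t c])
      show "t - s \<le> real k * (2 * B)" using k(1) B_pos by (simp add: field_simps)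
    qed (use st iso far e f in auto)
    also have "\<dots> \<le> ((t - s) / (2 * B) + 2) * B" using k(2) B_pos by (intro mult_right_mono) auto
    also have "\<dots> = (t - s) / 2 + 2 * B" using B_pos by (simp add: field_simps)
    finally show ?thesis
      using ae bf LD dist_triangle[of a b e] dist_triangle[of e b f]
      by (simp add: s_def t_def dist_commute) argo
  qed
qed

text \<open>
  Follow the geodesic from \<open>p\<close> until it first comes within \<open>3 * B\<close> of the set.  By
  \<open>far_path_projection\<close> this must happen, and the projection has hardly moved until then.
\<close>

lemma geodesic_passes_near:
  assumes p: "p' \<in> nearest_points S p" and q: "q' \<in> nearest_points S q" and far: "dist p' q' > 10 * B"
  obtains m where "dist p m + dist m q = dist p q" "dist m p' \<le> 13 * B"
proof -
  define L where "L = dist p q"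
  obtain c where c: "c 0 = p" "c L = q"
    and iso: "\<And>s t. 0 \<le> s \<Longrightarrow> s \<le> L \<Longrightarrow> 0 \<le> t \<Longrightarrow> t \<le> L \<Longrightarrow> dist (c s) (c t) = \<bar>s - t\<bar>"
    unfolding L_def by (rule geodesic_path[of p q]) blast
  define T where "T = {t \<in> {0..L}. infdist (c t) S \<le> 3 * B}"
  have "T \<noteq> {}"
  proof
    assume "T = {}"
    then have "infdist (c u) S > 2 * B" if "0 \<le> u" "u \<le> L" for u
      using that B_pos by (force simp: T_def)
    then have "dist p' q' \<le> 10 * B"
      using p q by (intro far_path_projection[of L c] iso) (auto simp: c, auto simp: L_def)
    then show False using far by simp
  qed
  moreover have "compact T"
  proof -
    have "continuous_on {0..L} (\<lambda>t. infdist (c t) S)"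
      by (intro continuous_intros continuous_on_geodesic_path iso)
    then have "closed ({0..L} \<inter> (\<lambda>t. infdist (c t) S) -` {..3 * B})"
      by (rule continuous_closed_preimage) auto
    also have "{0..L} \<inter> (\<lambda>t. infdist (c t) S) -` {..3 * B} = T" by (auto simp: T_def)
    finally have "closed T" .
    then have "compact ({0..L} \<inter> T)" by (intro compact_Int_closed compact_Icc)
    moreover have "{0..L} \<inter> T = T" by (auto simp: T_def)
    ultimately show ?thesis by simp
  qed
  ultimately have "\<exists>t\<in>T. \<forall>s\<in>T. t \<le> s" using compact_attains_inf by blast
  then obtain t where t: "t \<in> T" "\<And>s. s \<in> T \<Longrightarrow> t \<le> s" by blast
  have t': "0 \<le> t" "t \<le> L" "infdist (c t) S \<le> 3 * B" using t(1) by (auto simp: T_def)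
  have near: "dist (c t) p' \<le> 13 * B"
  proof (cases "t = 0")
    case True
    then show ?thesis using t' c p B_pos by (simp add: dist_nearest_point)
  next
    case False
    have before: "infdist (c u) S > 3 * B" if "0 \<le> u" "u < t" for u
      using t(2)[of u] that t' by (force simp: T_def)
    have "infdist (c t) S > 2 * B"
    proof (rule ccontr)
      assume neg: "\<not> ?thesis"
      define u where "u = max 0 (t - B)"
      have u: "0 \<le> u" "u < t" "t - u \<le> B" using False t' B_pos by (auto simp: u_def)
      have "infdist (c u) S \<le> infdist (c t) S + dist (c u) (c t)" by (rule infdist_triangle)
      also have "dist (c u) (c t) \<le> B" using iso[of u t] u t' by simp
      finally show False using before[of u] u neg by simp
    qed
    then have far': "infdist (c u) S > 2 * B" if "0 \<le> u" "u \<le> t" for u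
      using before[of u] that B_pos by (cases "u = t") auto
    obtain e where e: "e \<in> nearest_points S (c t)" by (rule nearest_exists)
    have "dist p' e \<le> 10 * B"
      using p e t' by (intro far_path_projection[of t c] iso far') (auto simp: c)
    then show ?thesis
      using dist_triangle[of "c t" p' e] dist_nearest_point[OF e] t'(3) by (simp add: dist_commute)
  qed
  have "dist p (c t) + dist (c t) q = dist p q"
    using iso[of 0 t] iso[of t L] t' c by (simp add: L_def[symmetric])
  then show thesis using near that by blast
qed

lemma projection_on_path:
  assumes "p' \<in> nearest_points S p" "q' \<in> nearest_points S q" "dist p' q' > 10 * B"
  shows "dist p p' + dist p' q \<le> dist p q + 26 * B"
proof -
  obtain m where "dist p m + dist m q = dist p q" "dist m p' \<le> 13 * B"
    by (rule geodesic_passes_near[OF assms])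
  then show ?thesis
    using dist_triangle[of p p' m] dist_triangle[of p' q m] by (simp add: dist_commute)
qed

lemma both_projections_on_path:
  assumes p: "p' \<in> nearest_points S p" and q: "q' \<in> nearest_points S q" and "dist p' q' > 10 * B"
  shows "dist p p' + dist p' q' + dist q' q \<le> dist p q + 52 * B"
proof -
  have "p' \<in> nearest_points S p'" using p by (simp add: nearest_points_def)
  from projection_on_path[OF q this] projection_on_path[OF assms] assms(3)
  show ?thesis by (simp add: dist_commute)
qed

lemma almost_nearest:
  assumes p: "p' \<in> nearest_points S p" and z: "z \<in> S" "dist p z \<le> dist p p' + 2 * B"
  shows "dist p' z \<le> 28 * B"
proof (cases "dist p' z > 10 * B")
  case True
  then show ?thesis using projection_on_path[OF p self_nearest[OF z(1)] True] z(2) by simp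
qed (use B_pos in simp)

lemma discrete_projection:
  fixes a :: "'i \<Rightarrow> 'a"
  assumes sub: "S \<subseteq> (\<Union>i\<in>I. ball (a i) B)" and sup: "a ` I \<subseteq> (\<Union>y\<in>S. ball y B)"
    and i: "i \<in> I" "\<And>k. k \<in> I \<Longrightarrow> dist p (a i) \<le> dist p (a k)"
    and p: "p' \<in> nearest_points S p"
  shows "dist p' (a i) \<le> 29 * B"
proof -
  have "p' \<in> S" using p by (simp add: nearest_points_def)
  then obtain k where k: "k \<in> I" "dist (a k) p' < B" using sub by auto
  obtain z where z: "z \<in> S" "dist z (a i) < B" using sup i(1) by force
  have "dist p z \<le> dist p p' + 2 * B"
    using dist_triangle[of p z "a i"] dist_triangle[of p "a k" p'] i(2)[OF k(1)] k(2) z(2)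
    by (simp add: dist_commute)
  from almost_nearest[OF p z(1) this] show ?thesis
    using z(2) dist_triangle[of p' "a i" z] by simp
qed

text \<open>
  Nearest points among a discrete set that is Hausdorff-close to \<open>S\<close> are almost nearest points of
  \<open>S\<close>.
\<close>

lemma discrete_projections_on_path:
  fixes a :: "'i \<Rightarrow> 'a"
  assumes H: "S \<subseteq> (\<Union>i\<in>I. ball (a i) B)" "a ` I \<subseteq> (\<Union>y\<in>S. ball y B)"
    and i: "i \<in> I" "\<And>k. k \<in> I \<Longrightarrow> dist p (a i) \<le> dist p (a k)"
    and j: "j \<in> I" "\<And>k. k \<in> I \<Longrightarrow> dist q (a j) \<le> dist q (a k)"
    and far: "dist (a i) (a j) > 70 * B"
  shows "dist p (a i) + dist (a i) (a j) + dist (a j) q \<le> dist p q + 168 * B"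
proof -
  obtain p' where p: "p' \<in> nearest_points S p" by (rule nearest_exists)
  obtain q' where q: "q' \<in> nearest_points S q" by (rule nearest_exists)
  have near: "dist p' (a i) \<le> 29 * B" "dist q' (a j) \<le> 29 * B"
    using discrete_projection[OF H] i j p q by blast+
  have "dist (a i) (a j) \<le> dist p' (a i) + dist p' q' + dist q' (a j)"
    using dist_triangle[of "a i" "a j" p'] dist_triangle[of p' "a j" q'] by (simp add: dist_commute)
  moreover have "dist p' q' > 10 * B" using calculation near far B_pos by linarith
  then have "dist p p' + dist p' q' + dist q' q \<le> dist p q + 52 * B"
    by (rule both_projections_on_path[OF p q])
  moreover have "dist p (a i) \<le> dist p p' + dist p' (a i)" "dist (a j) q \<le> dist q' (a j) + dist q' q"
    using dist_triangle[of p "a i" p'] dist_triangle[of "a j" q q'] by (simp_all add: dist_commute)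
  ultimately show ?thesis using near by linarith
qed

end

lemma geodesic_between:
  assumes "y \<in> geodesic a (b::'a::cat0_space)"
  shows "dist a y + dist y b = dist a b"
proof -
  obtain c where c: "c 0 = a" "c (dist a b) = b" "geodesic a b = c ` {0..dist a b}"
    and iso: "\<And>s t. 0 \<le> s \<Longrightarrow> s \<le> dist a b \<Longrightarrow> 0 \<le> t \<Longrightarrow> t \<le> dist a b \<Longrightarrow> dist (c s) (c t) = \<bar>s - t\<bar>"
    by (rule geodesic_path[of a b]) blast
  obtain t where t: "0 \<le> t" "t \<le> dist a b" "y = c t" using assms c(3) by auto
  show ?thesis using iso[of 0 t] iso[of t "dist a b"] t c(1,2) by simp
qed

text \<open>
  The slope \<open>r\<close> is both the supremum of \<open>(a l - b) / l\<close> and a lower bound of \<open>a k / k\<close>, because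
  \<open>a (k * l)\<close> can be estimated through \<open>a k\<close> as well as through \<open>a l\<close>.
\<close>

lemma nearly_additive_sequence:
  fixes a :: "nat \<Rightarrow> real"
  assumes sub: "\<And>k l. a (k + l) \<le> a k + a l" and super: "\<And>k l. a k + a l \<le> a (k + l) + b"
    and lim: "filterlim a at_top sequentially"
  obtains r where "r > 0" "\<And>k. r * real k \<le> a k" "\<And>k. a k \<le> r * real k + b"
proof -
  have b: "b \<ge> 0" using sub[of 0 0] super[of 0 0] by linarith
  have a0: "0 \<le> a 0" "a 0 \<le> b" using sub[of 0 0] super[of 0 0] by simp_all
  have mult_le: "a (k * l) \<le> real k * a l" if "k > 0" for k l
    using that
  proof (induction k rule: nat_induct_non_zero)
    case (Suc k) then show ?case using sub[of l "k * l"] by (simp add: algebra_simps)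
  qed simp
  have mult_ge: "real k * (a l - b) \<le> a (k * l) - b" if "k > 0" for k l
    using that
  proof (induction k rule: nat_induct_non_zero)
    case (Suc k) then show ?case using super[of l "k * l"] by (simp add: algebra_simps)
  qed simp
  have cross: "(a l - b) / real l \<le> a k / real k" if "k > 0" "l > 0" for k l
    using mult_le[of l k] mult_ge[of k l] that b by (simp add: field_simps mult.commute[of l k])
  define r where "r = (SUP l\<in>{0<..}. (a l - b) / real l)"
  have bdd: "bdd_above ((\<lambda>l. (a l - b) / real l) ` {0<..})"
    using cross[of 1] by (intro bdd_aboveI2[of _ _ "a 1 / real 1"]) auto
  have upper: "(a l - b) / real l \<le> r" if "l > 0" for l
    unfolding r_def using that by (intro cSUP_upper bdd) auto
  have lower: "r \<le> a k / real k" if "k > 0" for k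
    unfolding r_def using that cross by (intro cSUP_least) auto
  obtain l where l: "l > 0" "a l > b"
  proof -
    have "\<forall>\<^sub>F l in sequentially. a l > b \<and> l > 0"
      using lim eventually_gt_at_top[of 0] by (auto simp: filterlim_at_top_dense eventually_conj_iff)
    then show thesis using that by (auto simp: eventually_sequentially)
  qed
  have "r > 0" using upper[OF l(1)] l by (smt (verit) divide_pos_pos of_nat_0_less_iff)
  moreover have "r * real k \<le> a k" for k
    using lower[of k] a0 by (cases "k = 0") (auto simp: field_simps)
  moreover have "a k \<le> r * real k + b" for k
    using upper[of k] a0 by (cases "k = 0") (auto simp: field_simps)
  ultimately show thesis by (rule that)
qed

section \<open>The orbit of a rank 1 isometry\<close>

lemma multiple_succ: "multiple (i + 1) g = g + multiple i g"
proof (cases "i \<ge> 0")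
  case True
  then show ?thesis by (simp add: multiple_def nat_add_distrib)
next
  case False
  then have "nat (- i) = Suc (nat (- (i + 1)))" by simp
  then have "multiple i g = - g + ((+) (- g) ^^ nat (- (i + 1))) 0"
    using False by (simp only: multiple_def funpow.simps comp_apply) simp
  moreover have "multiple (i + 1) g = ((+) (- g) ^^ nat (- (i + 1))) 0"
    using False by (cases "i + 1 = 0") (simp_all add: multiple_def)
  ultimately show ?thesis by (simp add: add.assoc[symmetric])
qed

lemma multiple_add: "multiple (i + j) g = multiple i g + multiple j g"
proof (induction i rule: int_induct[of _ 0])
  case base then show ?case by (simp add: multiple_def)
next
  case (step1 i)
  then show ?case
    using multiple_succ[of "i + j" g] multiple_succ[of i g] by (simp add: ac_simps add.assoc)
next
  case (step2 i)
  have "g + multiple (i - 1 + j) g = multiple (i + j) g"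
    using multiple_succ[of "i - 1 + j" g] by (simp add: algebra_simps)
  also have "\<dots> = g + (multiple (i - 1) g + multiple j g)"
    using step2 multiple_succ[of "i - 1" g] by (simp add: add.assoc)
  finally show ?case by simp
qed

lemma action_multiple:
  assumes "isometric_action \<phi>"
  shows "\<phi> (multiple (int k) g) = \<phi> g ^^ k"
proof (induction k)
  case 0 then show ?case using assms by (simp add: multiple_def isometric_action_def id_def)
next
  case (Suc k)
  have "multiple (int (Suc k)) g = g + multiple (int k) g"
    using multiple_succ[of "int k" g] by (simp add: add.commute)
  then show ?case using Suc assms by (simp add: isometric_action_def)
qed

locale rank1_orbit =
  fixes \<phi> :: "'g::group_add \<Rightarrow> 'a::cat0_space \<Rightarrow> 'a" and x0 :: 'a and g :: 'g and B :: real
  assumes action: "isometric_action \<phi>"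
    and B_pos: "B > 0"
    and unbounded: "filterlim (\<lambda>k. dist ((\<phi> g ^^ k) x0) x0) at_top sequentially"
    and hausdorff: "k > 0 \<Longrightarrow>
      hausdorff_equivalent B (geodesic x0 ((\<phi> g ^^ k) x0)) ((\<lambda>i. (\<phi> g ^^ i) x0) ` {0..k})"
    and contracting: "k > 0 \<Longrightarrow> contracting B (geodesic x0 ((\<phi> g ^^ k) x0))"
begin

definition d :: "'g \<Rightarrow> 'g \<Rightarrow> real" where "d h k = dist (\<phi> h x0) (\<phi> k x0)"

abbreviation G :: "int \<Rightarrow> 'g" where "G i \<equiv> multiple i g"

lemma action_apply: "\<phi> (h + k) x = \<phi> h (\<phi> k x)" "\<phi> 0 x = x" "dist (\<phi> h x) (\<phi> h y) = dist x y"
  using action by (simp_all add: isometric_action_def isometry_def)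

lemma d_translate: "d (f + h) (f + k) = d h k"
  by (simp add: d_def action_apply)

lemma d_triangle: "d h l \<le> d h k + d k l"
  unfolding d_def by (rule dist_triangle)

lemma d_sym: "d h k = d k h"
  unfolding d_def by (rule dist_commute)

lemma d_G_nat: "d 0 (G (int k)) = dist x0 ((\<phi> g ^^ k) x0)"
  by (simp add: d_def action_apply action_multiple[OF action])

text \<open>
  The orbit point of \<open>k\<close> is within \<open>B\<close> of the geodesic to the orbit point of \<open>k + l\<close>.
\<close>

lemma d_G_superadditive: "d 0 (G (int k)) + d 0 (G (int l)) \<le> d 0 (G (int (k + l))) + 2 * B"
proof (cases "k + l = 0")
  case True then show ?thesis using B_pos d_G_nat[of 0] by simp
next
  case False
  let ?p = "\<lambda>i. (\<phi> g ^^ i) x0"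
  have "?p k \<in> ?p ` {0..k + l}" by (intro imageI) simp
  then obtain y where y: "y \<in> geodesic x0 (?p (k + l))" "dist y (?p k) < B"
    using hausdorff[of "k + l"] False unfolding hausdorff_equivalent_def by fastforce
  have "d (G (int k)) (G (int (k + l))) = d 0 (G (int l))"
    using d_translate[of "G (int k)" 0 "G (int l)"] by (simp add: multiple_add)
  then have "d 0 (G (int l)) = dist (?p k) (?p (k + l))"
    by (simp only: d_def action_multiple[OF action])
  then show ?thesis
    unfolding d_G_nat using geodesic_between[OF y(1)] y(2)
      dist_triangle[of x0 "?p k" y] dist_triangle[of "?p k" "?p (k + l)" y] dist_commute[of y "?p k"]
    by linarith
qed

lemma translation_length:
  obtains r where "r > 0" "\<And>i j. r * \<bar>real_of_int (i - j)\<bar> \<le> d (G i) (G j)"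
    "\<And>i j. d (G i) (G j) \<le> r * \<bar>real_of_int (i - j)\<bar> + 2 * B"
proof -
  have "d 0 (G (int (k + l))) \<le> d 0 (G (int k)) + d 0 (G (int l))" for k l
    using d_triangle[of 0 "G (int (k + l))" "G (int k)"] d_translate[of "G (int k)" 0 "G (int l)"]
    by (simp add: multiple_add)
  moreover have "filterlim (\<lambda>k. d 0 (G (int k))) at_top sequentially"
    using unbounded by (simp add: d_G_nat dist_commute)
  ultimately obtain r where r: "r > 0" "\<And>k. r * real k \<le> d 0 (G (int k))"
    "\<And>k. d 0 (G (int k)) \<le> r * real k + 2 * B"
    using nearly_additive_sequence[of "\<lambda>k. d 0 (G (int k))" "2 * B"] d_G_superadditive by metis
  have eq: "d (G i) (G j) = d 0 (G (int (nat \<bar>i - j\<bar>)))" for i j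
  proof -
    have *: "d (G i) (G j) = d 0 (G (j - i))" for i j
      using d_translate[of "G i" 0 "G (j - i)"] by (simp flip: multiple_add)
    show ?thesis using *[of i j] *[of j i] d_sym[of "G i" "G j"] by (cases "i \<le> j") auto
  qed
  show thesis
    using r(2,3)[of "nat \<bar>_ - _\<bar>"] by (intro that[OF r(1)]) (simp_all add: eq)
qed

definition nearest_indices :: "'g \<Rightarrow> int set" where
  "nearest_indices x = {i. \<forall>j. d x (G i) \<le> d x (G j)}"

text \<open>
  The least of the finitely many nearest indices; a canonical choice makes the index exactly
  equivariant.
\<close>

definition nearest_index :: "'g \<Rightarrow> int" where
  "nearest_index x = Min (nearest_indices x)"

lemma nearest_indices_finite_nonempty: "finite (nearest_indices x)" "nearest_indices x \<noteq> {}"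
proof -
  obtain r where r: "r > 0" "\<And>i j. r * \<bar>real_of_int (i - j)\<bar> \<le> d (G i) (G j)"
    by (rule translation_length) blast
  define J where "J = {i. d x (G i) \<le> d x (G 0)}"
  define b where "b = \<lceil>2 * d x (G 0) / r\<rceil>"
  \<comment> \<open>Orbit points of large index are further from \<open>x\<close> than \<open>G 0\<close>.\<close>
  have "J \<subseteq> {- b..b}"
  proof
    fix i assume "i \<in> J"
    then have "r * \<bar>real_of_int i\<bar> \<le> 2 * d x (G 0)"
      using r(2)[of i 0] d_triangle[of "G i" "G 0" x] d_sym[of x "G i"] by (simp add: J_def)
    then have "\<bar>real_of_int i\<bar> \<le> 2 * d x (G 0) / r" using r(1) by (simp add: field_simps)
    then show "i \<in> {- b..b}" unfolding b_def by simp linarith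
  qed
  then have fin: "finite J" by (rule finite_subset) simp
  have "nearest_indices x \<subseteq> J" by (auto simp: nearest_indices_def J_def)
  then show "finite (nearest_indices x)" using fin by (rule finite_subset)
  have "J \<noteq> {}" by (auto simp: J_def)
  then obtain i where i: "i \<in> J" "\<And>j. j \<in> J \<Longrightarrow> d x (G i) \<le> d x (G j)"
    using fin ex_min_if_finite[of "(\<lambda>i. d x (G i)) ` J"] by (metis arg_min_if_finite(1) arg_min_least)
  then have "i \<in> nearest_indices x"
    unfolding nearest_indices_def J_def by (smt (verit) mem_Collect_eq)
  then show "nearest_indices x \<noteq> {}" by blast
qed

lemma nearest_index_le: "d x (G (nearest_index x)) \<le> d x (G i)"
  using Min_in[OF nearest_indices_finite_nonempty, of x]
  unfolding nearest_index_def nearest_indices_def by blast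

lemma d_G_translate: "d (G k + x) (G i) = d x (G (i - k))"
  using d_translate[of "G k" x "G (i - k)"] by (simp flip: multiple_add)

lemma nearest_index_translate: "nearest_index (G k + x) = k + nearest_index x"
proof -
  have "nearest_indices (G k + x) = (+) k ` nearest_indices x"
  proof (intro equalityI subsetI)
    fix i assume i: "i \<in> nearest_indices (G k + x)"
    have "d x (G (i - k)) \<le> d x (G j)" for j
      using i[unfolded nearest_indices_def mem_Collect_eq d_G_translate, rule_format, of "j + k"] by simp
    then have "i - k \<in> nearest_indices x" unfolding nearest_indices_def by blast
    then show "i \<in> (+) k ` nearest_indices x" by (intro image_eqI[of _ _ "i - k"]) auto
  next
    fix i assume "i \<in> (+) k ` nearest_indices x"
    then show "i \<in> nearest_indices (G k + x)" by (auto simp: nearest_indices_def d_G_translate)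
  qed
  then show ?thesis
    unfolding nearest_index_def
    using mono_Min_commute[of "(+) k" "nearest_indices x"] nearest_indices_finite_nonempty[of x]
    by (simp add: mono_def)
qed

text \<open>
  The contracting segments start at the base point, so \<open>x\<close> and \<open>y\<close> are first moved by a power of
  \<open>g\<close> so large that the segment covers both nearest indices.
\<close>

lemma d_contraction:
  assumes "d (G (nearest_index x)) (G (nearest_index y)) > 70 * B"
  shows "d x (G (nearest_index x)) + d (G (nearest_index x)) (G (nearest_index y)) +
    d (G (nearest_index y)) y \<le> d x y + 168 * B"
proof -
  define i where "i = nearest_index x"
  define j where "j = nearest_index y"
  define m where "m = nat (\<bar>i\<bar> + \<bar>j\<bar> + 1)"
  define a where "a t = \<phi> (G (int t)) x0" for t :: nat
  have a: "(\<phi> g ^^ t) x0 = a t" for t by (simp add: a_def action_multiple[OF action])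
  define S where "S = geodesic x0 (a (2 * m))"
  have m: "2 * m > 0" by (simp add: m_def)
  interpret contracting_set S B
    by unfold_locales
      (use contracting[OF m] B_pos in \<open>simp_all add: S_def a compact_geodesic geodesic_nonempty\<close>)
  have H: "S \<subseteq> (\<Union>t\<in>{0..2 * m}. ball (a t) B)" "a ` {0..2 * m} \<subseteq> (\<Union>y\<in>S. ball y B)"
    using hausdorff[OF m] unfolding hausdorff_equivalent_def S_def a by auto
  define i' where "i' = nat (i + int m)"
  define j' where "j' = nat (j + int m)"
  have ij: "int i' = i + int m" "int j' = j + int m" "i' \<in> {0..2 * m}" "j' \<in> {0..2 * m}"
    by (auto simp: i'_def j'_def m_def)
  have dist_a: "dist (\<phi> (G (int m) + z) x0) (a t) = d z (G (int t - int m))" for z t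
    unfolding a_def d_def[symmetric] by (rule d_G_translate)
  have aa: "dist (a i') (a j') = d (G i) (G j)"
    unfolding a_def d_def[symmetric] ij using d_translate[of "G (int m)" "G i" "G j"]
    by (simp add: add.commute flip: multiple_add)
  have "dist (\<phi> (G (int m) + x) x0) (a i') + dist (a i') (a j') + dist (a j') (\<phi> (G (int m) + y) x0)
      \<le> dist (\<phi> (G (int m) + x) x0) (\<phi> (G (int m) + y) x0) + 168 * B"
  proof (rule discrete_projections_on_path[OF H ij(3) _ ij(4)])
    show "70 * B < dist (a i') (a j')" using assms unfolding aa i_def j_def .
  qed (simp_all add: dist_a ij i_def j_def nearest_index_le)
  moreover have "dist (a j') (\<phi> (G (int m) + y) x0) = d (G j) y"
    using dist_a[of y j'] by (simp add: ij dist_commute d_sym)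
  moreover have "dist (\<phi> (G (int m) + x) x0) (\<phi> (G (int m) + y) x0) = d x y"
    unfolding d_def[symmetric] by (rule d_translate)
  ultimately show ?thesis unfolding aa dist_a ij i_def[symmetric] j_def[symmetric] by simp
qed

lemma wpd_axis_orbit:
  assumes wpd: "\<And>c. c > 0 \<Longrightarrow> \<exists>M::nat. M > 0 \<and>
    finite {h. dist x0 (\<phi> h x0) \<le> c \<and> dist ((\<phi> g ^^ M) x0) (\<phi> h ((\<phi> g ^^ M) x0)) \<le> c}"
  obtains r where "wpd_axis (\<lambda>h. d 0 h / r) (\<lambda>i. multiple i g) nearest_index (168 * B / r)"
proof -
  obtain r where r: "r > 0" "\<And>i j. r * \<bar>real_of_int (i - j)\<bar> \<le> d (G i) (G j)"
    "\<And>i j. d (G i) (G j) \<le> r * \<bar>real_of_int (i - j)\<bar> + 2 * B"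
    by (rule translation_length) blast
  have d_eq: "d 0 (- x + y) = d x y" for x y
    using d_translate[of x 0 "- x + y"] by (simp add: add.assoc[symmetric])
  have G0: "G 0 = 0" by (simp add: multiple_def)
  show thesis
  proof (rule that, unfold_locales)
    fix x y :: 'g and i j :: int
    show "d 0 0 / r = 0" by (simp add: d_def)
    show "d 0 (- x) / r = d 0 x / r" using d_eq[of x 0] d_sym by simp
    show "d 0 (x + y) / r \<le> d 0 x / r + d 0 y / r"
      using d_triangle[of 0 "x + y" x] d_translate[of x 0 y] r(1)
      by (simp add: add_divide_distrib[symmetric] divide_right_mono)
    show "multiple (i + j) g = multiple i g + multiple j g" by (rule multiple_add)
    show "\<bar>d 0 (multiple i g) / r - \<bar>real_of_int i\<bar>\<bar> \<le> 168 * B / r"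
    proof -
      have "r * \<bar>real_of_int i\<bar> \<le> d 0 (G i)" "d 0 (G i) \<le> r * \<bar>real_of_int i\<bar> + 2 * B"
        using r(2,3)[of 0 i] G0 by simp_all
      then have "\<bar>d 0 (G i) - r * \<bar>real_of_int i\<bar>\<bar> \<le> 168 * B" using B_pos by linarith
      then have "\<bar>d 0 (G i) - r * \<bar>real_of_int i\<bar>\<bar> / r \<le> 168 * B / r"
        using r(1) by (simp add: divide_right_mono)
      moreover have "\<bar>d 0 (G i) - r * \<bar>real_of_int i\<bar>\<bar> / r = \<bar>(d 0 (G i) - r * \<bar>real_of_int i\<bar>) / r\<bar>"
        using r(1) by simp
      ultimately show ?thesis using r(1) by (simp add: diff_divide_distrib)
    qed
    show "d 0 (- x + multiple (nearest_index x) g) / r \<le> d 0 (- x + multiple i g) / r"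
      unfolding d_eq using nearest_index_le r(1) by (simp add: divide_right_mono)
    show "nearest_index (multiple i g + x) = i + nearest_index x" by (rule nearest_index_translate)
    show "168 * B / r > 0" using B_pos r(1) by simp
  next
    fix x y
    let ?i = "nearest_index x" and ?j = "nearest_index y"
    assume gap: "168 * B / r < \<bar>real_of_int (?i - ?j)\<bar>"
    have lower: "r * \<bar>real_of_int (?i - ?j)\<bar> \<le> d (G ?i) (G ?j)" by (rule r(2))
    moreover have "168 * B < r * \<bar>real_of_int (?i - ?j)\<bar>"
      using gap r(1) by (simp add: field_simps)
    ultimately have "d (G ?i) (G ?j) > 70 * B" using B_pos by linarith
    from d_contraction[OF this]
    have "d x (G ?i) + r * \<bar>real_of_int (?i - ?j)\<bar> + d y (G ?j) \<le> d x y + 168 * B"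
      using lower d_sym[of y "G ?j"] by linarith
    then have "(d x (G ?i) + r * \<bar>real_of_int (?i - ?j)\<bar> + d y (G ?j)) / r \<le> (d x y + 168 * B) / r"
      using r(1) by (intro divide_right_mono) auto
    then show "d 0 (- x + multiple ?i g) / r + \<bar>real_of_int (?i - ?j)\<bar> + d 0 (- y + multiple ?j g) / r
        \<le> d 0 (- x + y) / r + 168 * B / r"
      unfolding d_eq using r(1) by (simp add: add_divide_distrib)
  next
    fix c :: real assume "c > 0"
    then have "c * r > 0" using r(1) by simp
    from wpd[OF this] obtain M :: nat where M: "M > 0"
      "finite {h. dist x0 (\<phi> h x0) \<le> c * r \<and>
        dist ((\<phi> g ^^ M) x0) (\<phi> h ((\<phi> g ^^ M) x0)) \<le> c * r}" by blast
    have "{h. d 0 h / r \<le> c \<and> d 0 (- G (int M) + h + G (int M)) / r \<le> c} \<subseteq>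
      {h. dist x0 (\<phi> h x0) \<le> c * r \<and> dist ((\<phi> g ^^ M) x0) (\<phi> h ((\<phi> g ^^ M) x0)) \<le> c * r}"
      unfolding add.assoc d_eq using r(1)
      by (auto simp: d_def action_apply action_multiple[OF action] field_simps)
    then have "finite {h. d 0 h / r \<le> c \<and> d 0 (- G (int M) + h + G (int M)) / r \<le> c}"
      using M(2) by (rule finite_subset)
    then show "\<exists>M>0. finite {h. d 0 h / r \<le> c \<and> d 0 (- multiple M g + h + multiple M g) / r \<le> c}"
      using M(1) by (intro exI[of _ "int M"]) simp
  qed
qed

end

section \<open>Linear independence in the quotient\<close>

lemma abs_qh_tilde_sum:
  assumes "finite A" "\<And>i. i \<in> A \<Longrightarrow> quasi_hom (\<Phi> i)"
  shows "quasi_hom (\<lambda>x. \<Sum>i\<in>A. u i * \<Phi> i x) \<and>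
    (\<Sum>i\<in>A. u i *\<^sub>R abs_qh_tilde (\<Phi> i)) = abs_qh_tilde (\<lambda>x. \<Sum>i\<in>A. u i * \<Phi> i x)"
  using assms
proof (induction A rule: finite_induct)
  case empty
  then show ?case by (simp add: quasi_hom_zero zero_qh_tilde_def)
next
  case (insert a A)
  have a: "quasi_hom (\<lambda>x. u a * \<Phi> a x)" using insert.prems by (intro quasi_hom_scale) simp
  have "u a *\<^sub>R abs_qh_tilde (\<Phi> a) = abs_qh_tilde (\<lambda>x. u a * \<Phi> a x)"
    using insert.prems by (intro scaleR_qh_tilde.abs_eq) (simp add: qh_rel_refl)
  then show ?case
    using insert a by (simp add: quasi_hom_add plus_qh_tilde.abs_eq qh_rel_refl)
qed

lemma trivial_if_abs_zero:
  assumes "quasi_hom f" "abs_qh_tilde f = 0"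
  shows "trivial_quasi_hom f"
proof -
  have "qh_rel f (\<lambda>x. 0)"
    using assms Quotient3_rel[OF Quotient3_qh_tilde, of f "\<lambda>x. 0"]
    by (simp add: zero_qh_tilde_def qh_rel_refl quasi_hom_zero)
  then show ?thesis by (simp add: qh_rel_def)
qed

text \<open>
  In a relation between the classes, let \<open>i\<close> be the least index with a coefficient that is not zero.
  Evaluated at \<open>v i m\<close>, the relation leaves only the term of \<open>i\<close>, which is unbounded in \<open>m\<close>.
\<close>

lemma infinite_dimensional_if_triangular:
  fixes \<Phi> :: "nat \<Rightarrow> 'g::group_add \<Rightarrow> real" and v :: "nat \<Rightarrow> nat \<Rightarrow> 'g"
  assumes qh: "\<And>i. quasi_hom (\<Phi> i)" and diag: "\<And>i m. \<Phi> i (v i m) \<ge> real m"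
    and below: "\<And>i j m. j < i \<Longrightarrow> \<Phi> i (v j m) = 0"
    and hom: "\<And>f i m. real_hom f \<Longrightarrow> f (v i m) = 0"
  shows "\<not> (\<exists>B. finite B \<and> span B = (UNIV :: 'g qh_tilde set))"
proof -
  have zero: "\<forall>i\<in>A. u i = 0"
    if A: "finite A" and sum: "(\<Sum>i\<in>A. u i *\<^sub>R abs_qh_tilde (\<Phi> i)) = 0" for A u
  proof (rule ccontr)
    assume "\<not> (\<forall>i\<in>A. u i = 0)"
    define i where "i = (LEAST i. i \<in> A \<and> u i \<noteq> 0)"
    have i: "i \<in> A" "u i \<noteq> 0" "\<And>j. j \<in> A \<Longrightarrow> j < i \<Longrightarrow> u j = 0"
      using LeastI_ex[of "\<lambda>i. i \<in> A \<and> u i \<noteq> 0"] not_less_Least[of _ "\<lambda>i. i \<in> A \<and> u i \<noteq> 0"]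
        \<open>\<not> (\<forall>i\<in>A. u i = 0)\<close> unfolding i_def by blast+
    define f where "f x = (\<Sum>i\<in>A. u i * \<Phi> i x)" for x
    have "quasi_hom f" "abs_qh_tilde f = 0"
      using abs_qh_tilde_sum[OF A, of \<Phi> u] qh sum unfolding f_def by auto
    then have "trivial_quasi_hom f" by (rule trivial_if_abs_zero)
    then obtain h C where h: "real_hom h" "\<And>x. \<bar>f x - h x\<bar> \<le> C"
      unfolding trivial_quasi_hom_iff by blast
    have bound: "\<bar>u i\<bar> * real m \<le> C" for m
    proof -
      have "f (v i m) = (\<Sum>j\<in>{i}. u j * \<Phi> j (v i m))"
        unfolding f_def
      proof (rule sum.mono_neutral_right[OF A])
        show "\<forall>j\<in>A - {i}. u j * \<Phi> j (v i m) = 0"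
        proof
          fix j assume "j \<in> A - {i}"
          then show "u j * \<Phi> j (v i m) = 0"
            using i(3)[of j] below[of i j m] by (cases "j < i") auto
        qed
      qed (use i(1) in simp)
      then have "\<bar>u i\<bar> * \<Phi> i (v i m) \<le> C"
        using h(2)[of "v i m"] hom[OF h(1), of i m] diag[where i = i and m = m] by (simp add: abs_mult)
      moreover have "\<bar>u i\<bar> * real m \<le> \<bar>u i\<bar> * \<Phi> i (v i m)"
        using diag by (intro mult_left_mono) auto
      ultimately show ?thesis by linarith
    qed
    obtain m :: nat where "C / \<bar>u i\<bar> < real m" using reals_Archimedean2 by blast
    then show False using bound[of m] i(2) by (simp add: field_simps)
  qed
  define c where "c i = abs_qh_tilde (\<Phi> i)" for i
  have inj: "inj c"
  proof (rule injI, rule ccontr)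
    fix i j assume ij: "c i = c j" "i \<noteq> j"
    have "(\<Sum>k\<in>{i, j}. (if k = i then 1 else - 1) *\<^sub>R abs_qh_tilde (\<Phi> k)) = 0"
      using ij by (simp add: c_def)
    from zero[OF _ this] show False by auto
  qed
  have indep: "independent (range c)"
    unfolding dependent_explicit
  proof (rule notI, elim exE conjE bexE)
    fix S u w assume S: "finite S" "S \<subseteq> range c" "w \<in> S" "u w \<noteq> 0" "(\<Sum>w\<in>S. u w *\<^sub>R w) = 0"
    define A where "A = c -` S"
    have A: "finite A" "S = c ` A"
      using S(1,2) inj unfolding A_def by (auto intro: finite_vimageI)
    have "(\<Sum>i\<in>A. u (c i) *\<^sub>R abs_qh_tilde (\<Phi> i)) = 0"
      using S(5) inj unfolding A(2) by (subst (asm) sum.reindex) (auto simp: c_def[symmetric] inj_on_def inj_def)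
    from zero[OF A(1) this] show False using S(3,4) A(2) by auto
  qed
  show ?thesis
  proof
    assume "\<exists>B. finite B \<and> span B = (UNIV :: 'g qh_tilde set)"
    then obtain B :: "'g qh_tilde set" where B: "finite B" "span B = UNIV" by blast
    then have "finite (range c)" using independent_span_bound[OF B(1) indep] by auto
    then show False using inj finite_imageD by blast
  qed
qed

section \<open>The theorem\<close>

theorem mainTheorem1:
  fixes x0 :: "'a::cat0_space"
    and \<phi> :: "'g::group_add \<Rightarrow> 'a \<Rightarrow> 'a"
  assumes "isometric_action \<phi>"
    and "\<not> virtually_cyclic TYPE('g)"
    and "WPD x0 \<phi>"
    and "\<exists>g. rank1 x0 (\<phi> g)"
  shows "\<not> (\<exists>B. finite B \<and> span B = (UNIV :: 'g qh_tilde set))"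
proof -
  obtain g where g: "rank1 x0 (\<phi> g)" using assms(4) by blast
  obtain B where B: "B > 0" "\<And>n. n > 0 \<Longrightarrow>
      hausdorff_equivalent B (geodesic x0 ((\<phi> g ^^ n) x0)) ((\<lambda>i. (\<phi> g ^^ i) x0) ` {0..n}) \<and>
      contracting B (geodesic x0 ((\<phi> g ^^ n) x0))"
    using g unfolding rank1_def by blast
  interpret orbit: rank1_orbit \<phi> x0 g B
    by unfold_locales (use assms(1) g B in \<open>auto simp: rank1_def\<close>)
  obtain r where "wpd_axis (\<lambda>h. orbit.d 0 h / r) (\<lambda>i. multiple i g) orbit.nearest_index (168 * B / r)"
    using assms(3) g by (auto simp: WPD_def intro: orbit.wpd_axis_orbit)
  then interpret axis: wpd_axis "\<lambda>h. orbit.d 0 h / r" "\<lambda>i. multiple i g" orbit.nearest_index "168 * B / r" .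
  obtain C where C: "\<And>h. axis.parallel h \<or> (\<forall>i j. axis.gap (h + multiple i g) (h + multiple j g) \<le> C)"
    by (rule axis.parallel_or_bounded) blast
  have "\<exists>\<gamma>. \<not> axis.parallel \<gamma>"
    using axis.all_parallel_finite_cosets assms(2)
    unfolding virtually_cyclic_def cyclic_subgroup_def by blast
  then obtain \<gamma> where \<gamma>: "\<not> axis.parallel \<gamma>" by blast
  interpret transverse_translate "\<lambda>h. orbit.d 0 h / r" "\<lambda>i. multiple i g" orbit.nearest_index
    "168 * B / r" \<gamma> C
    by unfold_locales (use C \<gamma> in auto)
  show ?thesis
    using exists_independent_quasi_homs infinite_dimensional_if_triangular by metis
qed

end
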